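(* Let $(\sigma_n)_{n\ge 1}$, with $\sigma_n\in\mathrm{Hom}(\Gamma,\mathrm{Sym}(V_n))$ random with law $\mathbb{P}$, be an exponentially concentrated random sofic approximation to the free group $\Gamma$, and let $\mathtt{A}$ be a finite alphabet. Then there exist upper semicontinuous functions $h^\sharp,h^\flat\colon \mathrm{Prob}^\Gamma(\mathtt{A}^\Gamma)\to\{-\infty\}\cup[0,\log|\mathtt{A}|]$ with the following property: there exists a sequence of sets $S_n\subset\mathrm{Hom}(\Gamma,\mathrm{Sym}(V_n))$, $n\ge1$, such that $\mathbb{P}(\sigma_n\in S_n)\to 1$ as $n\to\infty$, and such that whenever $\tau_n\in S_n$ for each $n$, the sequence $\Sigma=\{\tau_n\}_{n=1}^\infty$ is a sofic approximation to $\Gamma$ and for all $\mu\in\mathrm{Prob}^\Gamma(\mathtt{A}^\Gamma)$ we have $$\overline{\mathrm{h}}_\Sigma(\mu)=h^\sharp(\mu)\quad\text{and}\quad \underline{\mathrm{h}}_\Sigma(\mu)=h^\flat(\mu).$$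
   Context: $\Gamma$ is the free group of rank $r$ with free generators $s_1,\dots,s_r$ and identity $e$; $d(\gamma,e)$ is word length. $\Gamma$ acts on $\mathtt{A}^\Gamma$ by $(g\cdot x)(h)=x(hg)$; $\mathrm{Prob}^\Gamma(\mathtt{A}^\Gamma)$ is the set of shift-invariant Borel probability measures, with the weak topology. For a finite set $V$, $\sigma\in\mathrm{Hom}(\Gamma,\mathrm{Sym}(V))$ and $x\in\mathtt{A}^V$, let $(\Pi_v^\sigma x)(h)=x(\sigma^h v)$ and $P_x^\sigma=\frac1{|V|}\sum_{v\in V}\delta_{\Pi_v^\sigma x}\in\mathrm{Prob}^\Gamma(\mathtt{A}^\Gamma)$. Give $\mathtt{A}^\Gamma$ the metric $d(x,y)=\sum_{\gamma\in\Gamma}\mathbf 1_{\{x(\gamma)\ne y(\gamma)\}}(5r^2)^{-d(\gamma,e)}$ and $\mathrm{Prob}^\Gamma(\mathtt{A}^\Gamma)$ the transportation metric $\overline d(\mu,\nu)=\sup\{|\int f\,d\mu-\int f\,d\nu| : f \text{ real-valued 1-Lipschitz on }\mathtt{A}^\Gamma\}$. Let $\Omega(\sigma,\mu,\varepsilon)=\{x\in\mathtt{A}^V:\overline d(P_x^\sigma,\mu)<\varepsilon\}$. For $\Sigma=\{\tau_n\in\mathrm{Hom}(\Gamma,\mathrm{Sym}(V_n))\}_{n\ge1}$ (with $\log 0=-\infty$): $\overline{\mathrm h}_\Sigma(\mu)=\inf_{\varepsilon>0}\limsup_{n}\frac1{|V_n|}\log|\Omega(\tau_n,\mu,\varepsilon)|$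 and $\underline{\mathrm h}_\Sigma(\mu)=\inf_{\varepsilon>0}\liminf_{n}\frac1{|V_n|}\log|\Omega(\tau_n,\mu,\varepsilon)|$. For finite $F\subset\Gamma$ and $\delta>0$, $\sigma$ is $(F,\delta)$-sofic if $\frac1{|V|}|\{v\in V:\sigma(\gamma_1)v\ne\sigma(\gamma_2)v\text{ for all distinct }\gamma_1,\gamma_2\in F\}|>1-\delta$. $\Sigma$ is a sofic approximation to $\Gamma$ if for every $(F,\delta)$, $\tau_n$ is $(F,\delta)$-sofic for all large $n$. A random sofic approximation is a sequence of random homomorphisms $\sigma_n\in\mathrm{Hom}(\Gamma,\mathrm{Sym}(V_n))$, with $V_n$ finite sets, such that for every $(F,\delta)$, $\limsup_n\frac1{|V_n|}\log\mathbb{P}\{\sigma_n\text{ is not }(F,\delta)\text{-sofic}\}=-\infty$. Two homomorphisms $\sigma_1,\sigma_2\in\mathrm{Hom}(\Gamma,\mathrm{Sym}(V))$ differ by a switching if for some $i,j\in V$ and $k\in\{1,\dots,r\}$, $\sigma_1^{s_k}(i)=\sigma_2^{s_k}(j)$, $\sigma_1^{s_k}(j)=\sigma_2^{s_k}(i)$, and the permutations $\sigma_1^{s_l},\sigma_2^{s_l}$ ($1\le l\le r$) are otherwise identical. Set $d(\sigma_1,\sigma_2)=m/|V|$ where $m$ is the minimal number of switchings needed to pass from $\sigma_1$ to $\sigma_2$. The sequence $(\sigma_n)$ is exponentially concentrated if there is a constant $C>0$ such that for every $n$, every 1-Lipschitz $f\colon\mathrm{Hom}(\Gamma,\mathrm{Sym}(V_n))\to\mathbb{R}$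 and every $t>0$, $\mathbb{P}\{|f(\sigma_n)-\mathbb{E}f(\sigma_n)|>t\}\le 2e^{-C|V_n|t^2}$. *)

theory Defs
  imports "HOL-Probability.Probability"
begin

section \<open>The free group on a finite set of generators\<close>

text \<open>
  A letter \<open>(k, True)\<close> stands for the generator \<open>s\<^sub>k\<close> and \<open>(k, False)\<close> for its inverse.
  The rank is the cardinality of the type \<open>'s\<close> of generators.
\<close>

inductive cancel_step :: "('s \<times> bool) list \<Rightarrow> ('s \<times> bool) list \<Rightarrow> bool" where
  "cancel_step (u @ (k, b) # (k, \<not> b) # v) (u @ v)"

abbreviation word_eq :: "('s \<times> bool) list \<Rightarrow> ('s \<times> bool) list \<Rightarrow> bool" where
  "word_eq \<equiv> equivclp cancel_step"

quotient_type 's free_group = "('s \<times> bool) list" / "equivclp cancel_step :: ('s \<times> bool) list \<Rightarrow> _"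
  by simp

definition word_inv :: "('s \<times> bool) list \<Rightarrow> ('s \<times> bool) list" where
  "word_inv w = rev (map (\<lambda>(k, b). (k, \<not> b)) w)"

lemma word_eq_map:
  assumes "\<And>x y. cancel_step x y \<Longrightarrow> word_eq (f x) (f y)" and "word_eq x y"
  shows "word_eq (f x) (f y)"
  using assms(2)
proof (induction rule: equivclp_induct)
  case base
  then show ?case by simp
next
  case (step y z)
  then have "word_eq (f y) (f z)"
    using assms(1) equivclp_sym by metis
  with step show ?case
    by (metis equivclp_trans)
qed

lemma word_eq_append_left: "word_eq x y \<Longrightarrow> word_eq (w @ x) (w @ y)"
proof (erule word_eq_map[rotated])
  fix x y :: "('a \<times> bool) list"
  assume "cancel_step x y"
  then show "word_eq (w @ x) (w @ y)"
    by cases (metis append.assoc cancel_step.intros r_into_equivclp)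
qed

lemma word_eq_append_right: "word_eq x y \<Longrightarrow> word_eq (x @ w) (y @ w)"
proof (erule word_eq_map[rotated])
  fix x y :: "('a \<times> bool) list"
  assume "cancel_step x y"
  then show "word_eq (x @ w) (y @ w)"
  proof cases
    case (1 u k b v)
    then show ?thesis
      using cancel_step.intros[of u k b "v @ w"] by (auto intro: r_into_equivclp)
  qed
qed

lemma word_eq_inv: "word_eq x y \<Longrightarrow> word_eq (word_inv x) (word_inv y)"
proof (erule word_eq_map[rotated])
  fix x y :: "('a \<times> bool) list"
  assume "cancel_step x y"
  then show "word_eq (word_inv x) (word_inv y)"
  proof cases
    case (1 u k b v)
    then show ?thesis
      using cancel_step.intros[of "word_inv v" k b "word_inv u"]
      by (auto simp: word_inv_def intro: r_into_equivclp)
  qed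
qed

lemma word_eq_inv_append: "word_eq (word_inv w @ w) []"
proof (induction w)
  case Nil
  then show ?case by (simp add: word_inv_def)
next
  case (Cons a w)
  obtain k b where a: "a = (k, b)" by force
  have "cancel_step (word_inv w @ (k, \<not> b) # (k, \<not> \<not> b) # w) (word_inv w @ w)"
    by (rule cancel_step.intros)
  then have "word_eq (word_inv (a # w) @ a # w) (word_inv w @ w)"
    by (auto simp: a word_inv_def intro: r_into_equivclp)
  then show ?case
    using Cons.IH by (metis equivclp_trans)
qed

instantiation free_group :: (type) "{monoid_mult, inverse}"
begin

lift_definition one_free_group :: "'a free_group" is "[]" .

lift_definition times_free_group :: "'a free_group \<Rightarrow> 'a free_group \<Rightarrow> 'a free_group" is "(@)"
  by (meson equivclp_trans word_eq_append_left word_eq_append_right)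

lift_definition inverse_free_group :: "'a free_group \<Rightarrow> 'a free_group" is word_inv
  by (rule word_eq_inv)

definition divide_free_group :: "'a free_group \<Rightarrow> 'a free_group \<Rightarrow> 'a free_group" where
  "divide_free_group g h = g * inverse h"

instance
  by standard (transfer, simp)+

end

lemma free_group_is_group: "group (*) (1 :: 's free_group) inverse"
proof
  show "inverse g * g = 1" for g :: "'s free_group"
    by transfer (rule word_eq_inv_append)
qed simp

lift_definition gen :: "'s \<Rightarrow> 's free_group" is "\<lambda>k. [(k, True)]" .

definition word_length :: "'s free_group \<Rightarrow> nat" where
  "word_length g = (LEAST n. \<exists>w. abs_free_group w = g \<and> length w = n)"


section \<open>Shift-invariant measures on the full shift\<close>

text \<open>
  The alphabet is a finite type carrying the discrete topology, so that the function type
  carries the product topology and \<open>borel\<close> is its Borel sigma-algebra.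
\<close>

definition shift :: "'s free_group \<Rightarrow> ('s free_group \<Rightarrow> 'a) \<Rightarrow> ('s free_group \<Rightarrow> 'a)" where
  "shift g x = (\<lambda>h. x (h * g))"

definition Prob_inv :: "('s::finite free_group \<Rightarrow> 'a::{finite, discrete_topology}) measure set" where
  "Prob_inv = {\<mu>. sets \<mu> = sets borel \<and> prob_space \<mu> \<and> (\<forall>g. distr \<mu> borel (shift g) = \<mu>)}"

definition weak_topology ::
    "('s::finite free_group \<Rightarrow> 'a::{finite, discrete_topology}) measure topology" where
  "weak_topology = topology_generated_by
     {{\<mu> \<in> Prob_inv. (\<integral>x. f x \<partial>\<mu>) \<in> U} | (f :: _ \<Rightarrow> real) U. continuous_on UNIV f \<and> open U}"

definition upper_semicontinuous_map :: "'b topology \<Rightarrow> ('b \<Rightarrow> ereal) \<Rightarrow> bool" where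
  "upper_semicontinuous_map X h \<longleftrightarrow> (\<forall>c. openin X {x \<in> topspace X. h x < c})"

definition shift_dist ::
    "('s::finite free_group \<Rightarrow> 'a) \<Rightarrow> ('s free_group \<Rightarrow> 'a) \<Rightarrow> real" where
  "shift_dist x y =
     (\<Sum>\<^sub>\<infinity>\<gamma>. of_bool (x \<gamma> \<noteq> y \<gamma>) * inverse ((5 * real CARD('s) ^ 2) ^ word_length \<gamma>))"

definition transport_dist ::
    "('s::finite free_group \<Rightarrow> 'a::{finite, discrete_topology}) measure
      \<Rightarrow> ('s free_group \<Rightarrow> 'a) measure \<Rightarrow> real" where
  "transport_dist \<mu> \<nu> =
     (SUP f \<in> {f. \<forall>x y. \<bar>f x - f y\<bar> \<le> shift_dist x y}. \<bar>(\<integral>x. f x \<partial>\<mu>) - (\<integral>x. f x \<partial>\<nu>)\<bar>)"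


section \<open>Homomorphisms to finite symmetric groups and sofic entropy\<close>

text \<open>
  \<open>Sym(V)\<close> consists of the \<open>p\<close> with \<open>p permutes V\<close>; these are the identity outside \<open>V\<close>,
  so a homomorphism is determined by its action on \<open>V\<close>.
\<close>

definition Homs :: "'v set \<Rightarrow> ('s free_group \<Rightarrow> 'v \<Rightarrow> 'v) set" where
  "Homs V = {\<sigma>. (\<forall>g. \<sigma> g permutes V) \<and> (\<forall>g h. \<sigma> (g * h) = \<sigma> g \<circ> \<sigma> h)}"

definition pullback_name ::
    "('s free_group \<Rightarrow> 'v \<Rightarrow> 'v) \<Rightarrow> ('v \<Rightarrow> 'a) \<Rightarrow> 'v \<Rightarrow> ('s free_group \<Rightarrow> 'a)" where
  "pullback_name \<sigma> x v = (\<lambda>h. x (\<sigma> h v))"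

text \<open>
  The average over \<open>v \<in> V\<close> of the point masses at \<open>pullback_name \<sigma> x v\<close> is the image of the
  uniform probability measure on \<open>V\<close>.
\<close>

definition empirical ::
    "'v set \<Rightarrow> ('s::finite free_group \<Rightarrow> 'v \<Rightarrow> 'v) \<Rightarrow> ('v \<Rightarrow> 'a::{finite, discrete_topology})
      \<Rightarrow> ('s free_group \<Rightarrow> 'a) measure" where
  "empirical V \<sigma> x = distr (uniform_count_measure V) borel (pullback_name \<sigma> x)"

definition good_models ::
    "'v set \<Rightarrow> ('s::finite free_group \<Rightarrow> 'v \<Rightarrow> 'v)
      \<Rightarrow> ('s free_group \<Rightarrow> 'a::{finite, discrete_topology}) measure \<Rightarrow> real \<Rightarrow> ('v \<Rightarrow> 'a) set" where
  "good_models V \<sigma> \<mu> \<epsilon> = {x \<in> V \<rightarrow>\<^sub>E UNIV. transport_dist (empirical V \<sigma> x) \<mu> < \<epsilon>}"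

definition elog :: "real \<Rightarrow> ereal" where
  "elog t = (if t = 0 then -\<infinity> else ereal (ln t))"

definition upper_entropy ::
    "(nat \<Rightarrow> 'v set) \<Rightarrow> (nat \<Rightarrow> 's::finite free_group \<Rightarrow> 'v \<Rightarrow> 'v)
      \<Rightarrow> ('s free_group \<Rightarrow> 'a::{finite, discrete_topology}) measure \<Rightarrow> ereal" where
  "upper_entropy V \<tau> \<mu> = (INF \<epsilon>\<in>{0<..}.
     limsup (\<lambda>n. elog (real (card (good_models (V n) (\<tau> n) \<mu> \<epsilon>))) / ereal (real (card (V n)))))"

definition lower_entropy ::
    "(nat \<Rightarrow> 'v set) \<Rightarrow> (nat \<Rightarrow> 's::finite free_group \<Rightarrow> 'v \<Rightarrow> 'v)
      \<Rightarrow> ('s free_group \<Rightarrow> 'a::{finite, discrete_topology}) measure \<Rightarrow> ereal" where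
  "lower_entropy V \<tau> \<mu> = (INF \<epsilon>\<in>{0<..}.
     liminf (\<lambda>n. elog (real (card (good_models (V n) (\<tau> n) \<mu> \<epsilon>))) / ereal (real (card (V n)))))"


section \<open>Sofic approximations and exponential concentration\<close>

definition sofic_hom ::
    "'v set \<Rightarrow> ('s free_group \<Rightarrow> 'v \<Rightarrow> 'v) \<Rightarrow> 's free_group set \<Rightarrow> real \<Rightarrow> bool" where
  "sofic_hom V \<sigma> F \<delta> \<longleftrightarrow>
     real (card {v \<in> V. \<forall>\<gamma>\<^sub>1\<in>F. \<forall>\<gamma>\<^sub>2\<in>F. \<gamma>\<^sub>1 \<noteq> \<gamma>\<^sub>2 \<longrightarrow> \<sigma> \<gamma>\<^sub>1 v \<noteq> \<sigma> \<gamma>\<^sub>2 v}) / real (card V) > 1 - \<delta>"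

definition sofic_approximation ::
    "(nat \<Rightarrow> 'v set) \<Rightarrow> (nat \<Rightarrow> 's free_group \<Rightarrow> 'v \<Rightarrow> 'v) \<Rightarrow> bool" where
  "sofic_approximation V \<tau> \<longleftrightarrow>
     (\<forall>n. finite (V n) \<and> V n \<noteq> {} \<and> \<tau> n \<in> Homs (V n)) \<and>
     (\<forall>F \<delta>. finite F \<and> \<delta> > 0 \<longrightarrow> (\<forall>\<^sub>F n in sequentially. sofic_hom (V n) (\<tau> n) F \<delta>))"

text \<open>
  Only the individual laws of the random homomorphisms matter, so each \<open>\<sigma> n\<close> may live on its
  own probability space \<open>M n\<close>; a common probability space is the case of constant \<open>M\<close>.
\<close>

definition random_homs ::
    "(nat \<Rightarrow> 'v set) \<Rightarrow> (nat \<Rightarrow> 'w measure) \<Rightarrow> (nat \<Rightarrow> 'w \<Rightarrow> 's free_group \<Rightarrow> 'v \<Rightarrow> 'v) \<Rightarrow> bool" where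
  "random_homs V M \<sigma> \<longleftrightarrow>
     (\<forall>n. finite (V n) \<and> V n \<noteq> {} \<and> prob_space (M n) \<and> \<sigma> n \<in> M n \<rightarrow>\<^sub>M count_space (Homs (V n)))"

definition random_sofic_approximation ::
    "(nat \<Rightarrow> 'v set) \<Rightarrow> (nat \<Rightarrow> 'w measure) \<Rightarrow> (nat \<Rightarrow> 'w \<Rightarrow> 's free_group \<Rightarrow> 'v \<Rightarrow> 'v) \<Rightarrow> bool" where
  "random_sofic_approximation V M \<sigma> \<longleftrightarrow> random_homs V M \<sigma> \<and>
     (\<forall>F \<delta>. finite F \<and> \<delta> > 0 \<longrightarrow>
        limsup (\<lambda>n. elog (measure (M n) {\<omega> \<in> space (M n). \<not> sofic_hom (V n) (\<sigma> n \<omega>) F \<delta>})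
                      / ereal (real (card (V n)))) = -\<infinity>)"

definition differ_by_switching ::
    "'v set \<Rightarrow> ('s free_group \<Rightarrow> 'v \<Rightarrow> 'v) \<Rightarrow> ('s free_group \<Rightarrow> 'v \<Rightarrow> 'v) \<Rightarrow> bool" where
  "differ_by_switching V \<sigma>\<^sub>1 \<sigma>\<^sub>2 \<longleftrightarrow> \<sigma>\<^sub>1 \<in> Homs V \<and> \<sigma>\<^sub>2 \<in> Homs V \<and>
     (\<exists>i\<in>V. \<exists>j\<in>V. \<exists>k.
        \<sigma>\<^sub>1 (gen k) i = \<sigma>\<^sub>2 (gen k) j \<and> \<sigma>\<^sub>1 (gen k) j = \<sigma>\<^sub>2 (gen k) i \<and>
        (\<forall>l. \<forall>v\<in>V. \<not> (l = k \<and> v \<in> {i, j}) \<longrightarrow> \<sigma>\<^sub>1 (gen l) v = \<sigma>\<^sub>2 (gen l) v))"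

text \<open>
  Any two homomorphisms are joined by finitely many switchings, so \<open>LEAST\<close> ranges over a
  nonempty set.
\<close>

definition hom_dist ::
    "'v set \<Rightarrow> ('s free_group \<Rightarrow> 'v \<Rightarrow> 'v) \<Rightarrow> ('s free_group \<Rightarrow> 'v \<Rightarrow> 'v) \<Rightarrow> real" where
  "hom_dist V \<sigma>\<^sub>1 \<sigma>\<^sub>2 = real (LEAST m. (differ_by_switching V ^^ m) \<sigma>\<^sub>1 \<sigma>\<^sub>2) / real (card V)"

definition exponentially_concentrated ::
    "(nat \<Rightarrow> 'v set) \<Rightarrow> (nat \<Rightarrow> 'w measure) \<Rightarrow> (nat \<Rightarrow> 'w \<Rightarrow> 's free_group \<Rightarrow> 'v \<Rightarrow> 'v) \<Rightarrow> bool" where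
  "exponentially_concentrated V M \<sigma> \<longleftrightarrow>
     (\<exists>C>0. \<forall>n. \<forall>f :: ('s free_group \<Rightarrow> 'v \<Rightarrow> 'v) \<Rightarrow> real.
        (\<forall>\<sigma>\<^sub>1\<in>Homs (V n). \<forall>\<sigma>\<^sub>2\<in>Homs (V n). \<bar>f \<sigma>\<^sub>1 - f \<sigma>\<^sub>2\<bar> \<le> hom_dist (V n) \<sigma>\<^sub>1 \<sigma>\<^sub>2) \<longrightarrow>
        (\<forall>t>0. measure (M n)
                 {\<omega> \<in> space (M n). \<bar>f (\<sigma> n \<omega>) - (\<integral>\<omega>'. f (\<sigma> n \<omega>') \<partial>M n)\<bar> > t}
               \<le> 2 * exp (- C * real (card (V n)) * t ^ 2)))"

end

theory Submission
  imports Defs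
begin

text \<open>
  The entropies of a sofic approximation count models: labellings of \<open>V\<close> whose empirical measure is
  within \<open>\<epsilon>\<close> of \<open>\<mu>\<close>.  Concentration of measure cannot be applied to the logarithm of this count, which
  may jump when the homomorphism changes slightly.  It does apply to the inverse function.  For a
  growth rate \<open>a\<close>, let the model radius of \<open>\<sigma>\<close> be the least \<open>\<epsilon>\<close> at which there are at least
  \<open>exp (a |V|)\<close> models.  One switching moves the empirical measure of every labelling by no more than
  a constant over \<open>|V|\<close> (\<open>switching_moves_empirical\<close>), because an element of length \<open>l\<close> feels the
  switching at no more than \<open>2l\<close> points and the weights decay faster than the spheres of the free
  group grow.  So the model radius is Lipschitz in \<open>\<sigma>\<close> (\<open>model_radius_lipschitz\<close>), and since \<open>|V n|\<close>
  tends to infinity (\<open>card_tendsto_infinity\<close>) the model radius of the random homomorphism is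
  close to its mean with probability tending to 1.

  To treat all measures together, the target measure is restricted to the countable set of all
  empirical measures and the growth rate to the rationals.  A diagonal choice
  (\<open>diagonal_good_sets\<close>) gives sets \<open>S n\<close> of probability tending to 1 that eventually avoid each of
  the resulting countably many exceptional events, as well as the failures of soficity.  Any two
  sequences in these sets have asymptotically equal model radii.  Since an invariant measure
  either is a limit of empirical measures or has no models at small radius, equal
  radii give equal upper and lower entropies for every measure (\<open>entropies_le\<close>).

  The two functions of the theorem are therefore the entropies along any fixed sequence in the
  sets \<open>S n\<close>.  They are upper semicontinuous because transportation balls contain weak
  neighbourhoods (\<open>weak_neighbourhood_in_transport_ball\<close>) and a small change of the measure is
  absorbed by a small change of \<open>\<epsilon>\<close>.
\<close>

section \<open>Word length and summability of the weights\<close>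

lemma abs_free_group_Nil: "abs_free_group [] = 1"
  by (simp add: one_free_group_def)

lemma abs_free_group_Cons:
  "abs_free_group ((k, b) # w) = (if b then gen k else inverse (gen k)) * abs_free_group w"
  by (simp add: gen.abs_eq inverse_free_group.abs_eq times_free_group.abs_eq word_inv_def)

lemma ex_abs_free_group: "\<exists>w. abs_free_group w = g"
  by (metis Quotient3_abs_rep Quotient3_free_group)

lemma shortest_word: "\<exists>w. abs_free_group w = g \<and> length w = word_length g"
  unfolding word_length_def by (rule LeastI_ex) (use ex_abs_free_group in blast)

lemma countable_free_group: "countable (UNIV :: 's::finite free_group set)"
proof -
  have "UNIV = range (abs_free_group :: ('s \<times> bool) list \<Rightarrow> _)"
    by (auto simp: image_iff) (metis ex_abs_free_group)
  then show ?thesis by (metis countable_image countableI_type)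
qed

text \<open>
  The shortest words inject the sphere of radius \<open>l\<close> into the words of length \<open>l\<close>.
\<close>

lemma sphere_finite: "finite {g :: 's::finite free_group. word_length g = l}" (is "finite ?S")
  and card_sphere_le: "card {g :: 's::finite free_group. word_length g = l} \<le> (2 * CARD('s)) ^ l"
proof -
  let ?W = "{w :: ('s \<times> bool) list. length w = l}"
  have W: "finite ?W" "card ?W = (2 * CARD('s)) ^ l"
    using finite_lists_length_eq[of "UNIV :: ('s \<times> bool) set" l]
      card_lists_length_eq[of "UNIV :: ('s \<times> bool) set" l]
    by (simp_all add: mult.commute)
  have sub: "?S \<subseteq> abs_free_group ` ?W"
    using shortest_word by (force simp: image_iff)
  show "finite ?S" using sub W(1) finite_surj by blast
  show "card ?S \<le> (2 * CARD('s)) ^ l"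
    using surj_card_le[OF W(1) sub] W(2) by simp
qed

definition weight :: "'s::finite free_group \<Rightarrow> real" where
  "weight g = inverse ((5 * real CARD('s) ^ 2) ^ word_length g)"

lemma weight_pos: "weight g > 0"
  by (simp add: weight_def)

text \<open>
  A sphere of radius \<open>l\<close> has at most \<open>(2r)\<^sup>l\<close> elements, each of weight \<open>(5r\<^sup>2)\<^sup>-\<^sup>l\<close>, and
  \<open>2r / 5r\<^sup>2 \<le> 2/5\<close>.  The geometric decay leaves room for the extra factor \<open>1 + l\<close>, which is what
  pays for switchings: changing a generator at two points can affect the action of an element
  of length \<open>l\<close> at about \<open>2l\<close> points.
\<close>

lemma summable_length_weight:
  "(\<lambda>g :: 's::finite free_group. (1 + real (word_length g)) * weight g) summable_on UNIV"
proof (rule nonneg_bdd_above_summable_on)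
  show "0 \<le> (1 + real (word_length g)) * weight g" for g :: "'s free_group"
    using weight_pos[of g] by simp
  let ?b = "\<lambda>l. real (Suc l) * (2/5) ^ l"
  have b: "summable ?b"
    using geometric_deriv_sums[of "2/5::real"] by (simp add: sums_iff)
  have r1: "real CARD('s) \<ge> 1"
    using card_gt_0_iff[of "UNIV :: 's set"] by (simp add: Suc_leI)
  have "sum (\<lambda>g. (1 + real (word_length g)) * weight g) F \<le> suminf ?b"
    if F: "finite F" for F :: "'s free_group set"
  proof -
    let ?f = "\<lambda>g :: 's free_group. (1 + real (word_length g)) * weight g"
    have level: "sum ?f {g \<in> F. word_length g = l} \<le> ?b l" for l
    proof -
      let ?c = "inverse ((5 * real CARD('s) ^ 2) ^ l)"
      have "sum ?f {g \<in> F. word_length g = l} = real (card {g \<in> F. word_length g = l}) * (real (Suc l) * ?c)"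
        by (simp add: weight_def)
      also have "\<dots> \<le> real ((2 * CARD('s)) ^ l) * (real (Suc l) * ?c)"
      proof (rule mult_right_mono)
        have "card {g \<in> F. word_length g = l} \<le> card {g :: 's free_group. word_length g = l}"
          by (rule card_mono) (auto simp: sphere_finite)
        then show "real (card {g \<in> F. word_length g = l}) \<le> real ((2 * CARD('s)) ^ l)"
          using card_sphere_le[where 's='s, of l] by linarith
      qed simp
      also have "\<dots> = real (Suc l) * ((2 * real CARD('s)) / (5 * real CARD('s) ^ 2)) ^ l"
        by (simp add: power_divide field_simps)
      also have "(2 * real CARD('s)) / (5 * real CARD('s) ^ 2) = 2 / (5 * real CARD('s))"
        using r1 by (simp add: power2_eq_square)
      also have "real (Suc l) * (2 / (5 * real CARD('s))) ^ l \<le> ?b l"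
        using r1 by (intro mult_left_mono power_mono) (auto simp: field_simps)
      finally show ?thesis .
    qed
    have "sum ?f F = (\<Sum>l\<in>word_length ` F. sum ?f {g \<in> F. word_length g = l})"
      by (rule sum.group[symmetric]) (use F in auto)
    also have "\<dots> \<le> (\<Sum>l\<in>word_length ` F. ?b l)"
      by (rule sum_mono) (rule level)
    also have "\<dots> \<le> suminf ?b"
      by (rule sum_le_suminf) (use F b in auto)
    finally show ?thesis .
  qed
  then show "bdd_above (sum (\<lambda>g. (1 + real (word_length g)) * weight g) ` {F :: 's free_group set. F \<subseteq> UNIV \<and> finite F})"
    by (intro bdd_aboveI[where M="suminf ?b"]) auto
qed

lemma summable_weight: "weight summable_on A"
proof -
  have "weight summable_on (UNIV :: 'a free_group set)"
    by (rule summable_on_comparison_test[OF summable_length_weight])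
      (auto simp: less_imp_le[OF weight_pos] field_simps)
  then show ?thesis by (rule summable_on_subset_banach) simp
qed

definition total_weight :: "'s::finite itself \<Rightarrow> real" where
  "total_weight _ = (\<Sum>\<^sub>\<infinity>g :: 's free_group. weight g)"

section \<open>The metric on configurations\<close>

lemma shift_dist_weight: "shift_dist x y = (\<Sum>\<^sub>\<infinity>g. of_bool (x g \<noteq> y g) * weight g)"
  by (simp add: shift_dist_def weight_def)

lemma summable_disagreement: "(\<lambda>g. of_bool (P g) * weight g) summable_on A"
  by (rule summable_on_comparison_test[OF summable_weight])
    (auto simp: less_imp_le[OF weight_pos])

lemma shift_dist_nonneg: "0 \<le> shift_dist x y"
  unfolding shift_dist_weight by (rule infsum_nonneg) (simp add: less_imp_le[OF weight_pos])

lemma shift_dist_le_total: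
  "shift_dist (x :: 's::finite free_group \<Rightarrow> 'a) y \<le> total_weight TYPE('s)"
  unfolding shift_dist_weight total_weight_def
  by (rule infsum_mono[OF summable_disagreement summable_weight])
    (simp add: less_imp_le[OF weight_pos])

text \<open>
  Only a finite part of the total weight matters up to \<open>\<epsilon>\<close>: the metric is compatible with the
  product topology.
\<close>

lemma shift_dist_small_if_agree:
  fixes \<epsilon> :: real assumes "\<epsilon> > 0"
  shows "\<exists>F :: 's::finite free_group set. finite F \<and>
    (\<forall>x y :: 's free_group \<Rightarrow> 'a. (\<forall>g\<in>F. x g = y g) \<longrightarrow> shift_dist x y < \<epsilon>)"
proof -
  have "((weight :: 's free_group \<Rightarrow> real) has_sum infsum weight (UNIV :: 's free_group set)) UNIV"
    by (rule has_sum_infsum[OF summable_weight])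
  then have "\<forall>\<^sub>F F in finite_subsets_at_top (UNIV :: 's free_group set).
      dist (sum weight F) (infsum weight (UNIV :: 's free_group set)) < \<epsilon>"
    unfolding has_sum_def using assms by (rule tendstoD)
  then obtain F :: "'s free_group set" where F: "finite F"
    "dist (sum weight F) (infsum weight (UNIV :: 's free_group set)) < \<epsilon>"
    unfolding eventually_finite_subsets_at_top by auto
  have tail: "infsum weight (UNIV - F) < \<epsilon>"
  proof -
    have "infsum weight (UNIV - F) = infsum weight (UNIV :: 's free_group set) - infsum weight F"
      by (rule infsum_Diff) (auto simp: summable_weight)
    also have "infsum weight F = sum weight F" using F(1) by simp
    finally show ?thesis using F(2) by (simp add: dist_real_def)
  qed
  show ?thesis
  proof (intro exI conjI allI impI)
    show "finite F" by (rule F(1))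
    fix x y :: "'s free_group \<Rightarrow> 'a"
    assume eq: "\<forall>g\<in>F. x g = y g"
    have "shift_dist x y = (\<Sum>\<^sub>\<infinity>g\<in>UNIV - F. of_bool (x g \<noteq> y g) * weight g)"
      unfolding shift_dist_weight by (rule infsum_cong_neutral) (auto simp: eq)
    also have "\<dots> \<le> infsum weight (UNIV - F)"
      by (rule infsum_mono[OF summable_disagreement summable_weight])
        (simp add: less_imp_le[OF weight_pos])
    finally show "shift_dist x y < \<epsilon>" using tail by simp
  qed
qed

definition cylinder :: "'g set \<Rightarrow> ('g \<Rightarrow> 'a) \<Rightarrow> ('g \<Rightarrow> 'a) set" where
  "cylinder F x = {y. \<forall>g\<in>F. y g = x g}"

lemma open_cylinder:
  fixes x :: "'g \<Rightarrow> 'a::discrete_topology"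
  assumes "finite F" shows "open (cylinder F x)"
proof -
  have "cylinder F x = (\<Inter>g\<in>F. (\<lambda>y. y g) -` {x g})" by (auto simp: cylinder_def)
  moreover have "open ((\<lambda>y :: 'g \<Rightarrow> 'a. y g) -` {x g})" for g
    using discrete_topology_class.open_discrete[of "{x g}"] by (intro open_vimage) auto
  ultimately show ?thesis using assms by auto
qed

definition shift_lipschitz :: "(('s::finite free_group \<Rightarrow> 'a) \<Rightarrow> real) \<Rightarrow> bool" where
  "shift_lipschitz f \<longleftrightarrow> (\<forall>x y. \<bar>f x - f y\<bar> \<le> shift_dist x y)"

text \<open>
  Continuity is what makes the test functions in the transportation distance measurable, so that
  the integrals in that distance are genuine.
\<close>

lemma shift_lipschitz_continuous:
  fixes f :: "('s::finite free_group \<Rightarrow> 'a::discrete_topology) \<Rightarrow> real"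
  assumes f: "shift_lipschitz f"
  shows "continuous_on UNIV f"
  unfolding continuous_on_def
proof (rule ballI)
  fix x
  show "(f \<longlongrightarrow> f x) (at x)"
  proof (rule tendstoI)
    fix \<epsilon> :: real assume "\<epsilon> > 0"
    then obtain F :: "'s free_group set" where F: "finite F"
      "\<And>x y :: 's free_group \<Rightarrow> 'a. (\<forall>g\<in>F. x g = y g) \<Longrightarrow> shift_dist x y < \<epsilon>"
      using shift_dist_small_if_agree by blast
    have "dist (f y) (f x) < \<epsilon>" if "y \<in> cylinder F x" for y
    proof -
      have "dist (f y) (f x) \<le> shift_dist y x"
        using f by (simp add: shift_lipschitz_def dist_real_def)
      also have "\<dots> < \<epsilon>" using that by (intro F(2)) (simp add: cylinder_def)
      finally show ?thesis .
    qed
    then show "\<forall>\<^sub>F y in at x. dist (f y) (f x) < \<epsilon>"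
      unfolding eventually_at_topological
      by (intro exI[of _ "cylinder F x"]) (auto simp: open_cylinder F(1), simp add: cylinder_def)
  qed
qed

section \<open>The transportation distance\<close>

definition borel_probs :: "('b::topological_space) measure set" where
  "borel_probs = {\<mu>. sets \<mu> = sets borel \<and> prob_space \<mu>}"

lemma Prob_inv_borel: "\<mu> \<in> Prob_inv \<Longrightarrow> \<mu> \<in> borel_probs"
  by (simp add: Prob_inv_def borel_probs_def)

lemma shift_lipschitz_abs_le:
  fixes f :: "('s::finite free_group \<Rightarrow> 'a) \<Rightarrow> real"
  assumes "shift_lipschitz f"
  shows "\<bar>f x - f y\<bar> \<le> total_weight TYPE('s)"
  using assms shift_dist_le_total order_trans unfolding shift_lipschitz_def by blast

lemma shift_lipschitz_integrable:
  fixes f :: "('s::finite free_group \<Rightarrow> 'a::discrete_topology) \<Rightarrow> real"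
  assumes f: "shift_lipschitz f" and \<mu>: "\<mu> \<in> borel_probs"
  shows "integrable \<mu> f"
proof -
  interpret prob_space \<mu> using \<mu> by (simp add: borel_probs_def)
  have "f \<in> borel_measurable borel"
    by (rule borel_measurable_continuous_onI[OF shift_lipschitz_continuous[OF f]])
  then have m: "f \<in> borel_measurable \<mu>"
    using \<mu> by (simp add: borel_probs_def cong: measurable_cong_sets)
  show ?thesis
  proof (rule integrable_const_bound[OF _ m])
    show "AE x in \<mu>. norm (f x) \<le> \<bar>f undefined\<bar> + total_weight TYPE('s)"
    proof (rule AE_I2)
      fix x
      show "norm (f x) \<le> \<bar>f undefined\<bar> + total_weight TYPE('s)"
        using shift_lipschitz_abs_le[OF f, of x undefined] unfolding real_norm_def by linarith
    qed
  qed
qed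

lemma integral_gap_bounded:
  fixes f :: "('s::finite free_group \<Rightarrow> 'a::discrete_topology) \<Rightarrow> real"
  assumes f: "shift_lipschitz f" and \<mu>: "\<mu> \<in> borel_probs" and \<nu>: "\<nu> \<in> borel_probs"
  shows "\<bar>(\<integral>x. f x \<partial>\<mu>) - (\<integral>x. f x \<partial>\<nu>)\<bar> \<le> 2 * total_weight TYPE('s)"
proof -
  have near: "\<bar>(\<integral>x. f x \<partial>\<mu>) - f undefined\<bar> \<le> total_weight TYPE('s)"
    if \<mu>: "\<mu> \<in> borel_probs" for \<mu>
  proof -
    interpret prob_space \<mu> using \<mu> by (simp add: borel_probs_def)
    note int = shift_lipschitz_integrable[OF f \<mu>]
    have b: "f undefined - total_weight TYPE('s) \<le> f x" "f x \<le> f undefined + total_weight TYPE('s)" for x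
      using shift_lipschitz_abs_le[OF f, of x undefined] by (simp_all add: abs_le_iff)
    show ?thesis
      using integral_le_const[OF int, of "f undefined + total_weight TYPE('s)"]
        integral_ge_const[OF int, of "f undefined - total_weight TYPE('s)"] b
      by (simp add: abs_le_iff)
  qed
  show ?thesis using near[OF \<mu>] near[OF \<nu>] by linarith
qed

lemma transport_dist_upper:
  fixes f :: "('s::finite free_group \<Rightarrow> 'a::{finite, discrete_topology}) \<Rightarrow> real"
  assumes "shift_lipschitz f" "\<mu> \<in> borel_probs" "\<nu> \<in> borel_probs"
  shows "\<bar>(\<integral>x. f x \<partial>\<mu>) - (\<integral>x. f x \<partial>\<nu>)\<bar> \<le> transport_dist \<mu> \<nu>"
  unfolding transport_dist_def
proof (rule cSUP_upper)
  show "bdd_above ((\<lambda>f. \<bar>(\<integral>x. f x \<partial>\<mu>) - (\<integral>x. f x \<partial>\<nu>)\<bar>) `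
      {f :: ('s free_group \<Rightarrow> 'a) \<Rightarrow> real. \<forall>x y. \<bar>f x - f y\<bar> \<le> shift_dist x y})"
    by (rule bdd_aboveI[where M="2 * total_weight TYPE('s)"])
      (auto intro: integral_gap_bounded assms simp: shift_lipschitz_def)
qed (use assms in \<open>simp add: shift_lipschitz_def\<close>)

lemma transport_dist_least:
  assumes "\<And>f. shift_lipschitz f \<Longrightarrow> \<bar>(\<integral>x. f x \<partial>\<mu>) - (\<integral>x. f x \<partial>\<nu>)\<bar> \<le> B"
  shows "transport_dist \<mu> \<nu> \<le> B"
  unfolding transport_dist_def
proof (rule cSUP_least)
  show "{f :: ('a free_group \<Rightarrow> 'b) \<Rightarrow> real. \<forall>x y. \<bar>f x - f y\<bar> \<le> shift_dist x y} \<noteq> {}"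
    using shift_dist_nonneg by (auto intro!: exI[of _ "\<lambda>_. 0"])
qed (use assms in \<open>auto simp: shift_lipschitz_def\<close>)

lemma transport_dist_refl: "transport_dist \<mu> \<mu> \<le> 0"
  by (rule transport_dist_least) simp

lemma transport_dist_commute: "transport_dist \<mu> \<nu> = transport_dist \<nu> \<mu>"
  unfolding transport_dist_def by (simp add: abs_minus_commute)

lemma transport_dist_triangle:
  assumes "\<mu> \<in> borel_probs" "\<nu> \<in> borel_probs" "\<rho> \<in> borel_probs"
  shows "transport_dist \<mu> \<rho> \<le> transport_dist \<mu> \<nu> + transport_dist \<nu> \<rho>"
proof (rule transport_dist_least)
  fix f :: "('a free_group \<Rightarrow> 'b) \<Rightarrow> real"
  assume f: "shift_lipschitz f"
  show "\<bar>(\<integral>x. f x \<partial>\<mu>) - (\<integral>x. f x \<partial>\<rho>)\<bar> \<le> transport_dist \<mu> \<nu> + transport_dist \<nu> \<rho>"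
    using transport_dist_upper[OF f assms(1,2)] transport_dist_upper[OF f assms(2,3)] by linarith
qed

section \<open>Homomorphisms into a finite symmetric group\<close>

lemma hom_mult: "\<sigma> \<in> Homs V \<Longrightarrow> \<sigma> (g * h) v = \<sigma> g (\<sigma> h v)"
  by (simp add: Homs_def)

lemma hom_permutes: "\<sigma> \<in> Homs V \<Longrightarrow> \<sigma> g permutes V"
  by (simp add: Homs_def)

lemma hom_in: "\<sigma> \<in> Homs V \<Longrightarrow> v \<in> V \<Longrightarrow> \<sigma> g v \<in> V"
  using hom_permutes permutes_in_image by metis

lemma hom_one:
  assumes "\<sigma> \<in> Homs V" shows "\<sigma> 1 v = v"
proof -
  have "\<sigma> 1 (\<sigma> 1 v) = \<sigma> 1 v" using hom_mult[OF assms, of 1 1 v] by simp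
  then show ?thesis using permutes_inj[OF hom_permutes[OF assms]] by (simp add: inj_eq)
qed

lemma hom_inverse:
  fixes \<sigma> :: "'s::finite free_group \<Rightarrow> 'v \<Rightarrow> 'v"
  assumes "\<sigma> \<in> Homs V"
  shows "\<sigma> (inverse g) (\<sigma> g v) = v" and "\<sigma> g (\<sigma> (inverse g) v) = v"
proof -
  show "\<sigma> (inverse g) (\<sigma> g v) = v"
    using hom_mult[OF assms, of "inverse g" g v] hom_one[OF assms]
    by (simp add: group.left_inverse[OF free_group_is_group])
  show "\<sigma> g (\<sigma> (inverse g) v) = v"
    using hom_mult[OF assms, of g "inverse g" v] hom_one[OF assms]
    by (simp add: group.right_inverse[OF free_group_is_group])
qed

definition disagreement ::
  "'v set \<Rightarrow> ('s free_group \<Rightarrow> 'v \<Rightarrow> 'v) \<Rightarrow> ('s free_group \<Rightarrow> 'v \<Rightarrow> 'v) \<Rightarrow> 's free_group \<Rightarrow> 'v set" where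
  "disagreement V \<sigma>\<^sub>1 \<sigma>\<^sub>2 g = {v \<in> V. \<sigma>\<^sub>1 g v \<noteq> \<sigma>\<^sub>2 g v}"

lemma finite_disagreement: "finite V \<Longrightarrow> finite (disagreement V \<sigma>\<^sub>1 \<sigma>\<^sub>2 g)"
  by (simp add: disagreement_def)

text \<open>
  If the two actions of \<open>g * h\<close> differ at \<open>v\<close>, then either those of \<open>h\<close> differ at \<open>v\<close>, or those of
  \<open>g\<close> differ at the common image of \<open>v\<close> under \<open>h\<close>; the latter points are carried injectively by \<open>h\<close>.
\<close>

lemma card_disagreement_mult_le:
  assumes V: "finite V" and \<sigma>: "\<sigma>\<^sub>1 \<in> Homs V" "\<sigma>\<^sub>2 \<in> Homs V"
  shows "card (disagreement V \<sigma>\<^sub>1 \<sigma>\<^sub>2 (g * h))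
    \<le> card (disagreement V \<sigma>\<^sub>1 \<sigma>\<^sub>2 g) + card (disagreement V \<sigma>\<^sub>1 \<sigma>\<^sub>2 h)"
proof -
  let ?B = "{v \<in> V. \<sigma>\<^sub>1 h v \<in> disagreement V \<sigma>\<^sub>1 \<sigma>\<^sub>2 g}"
  have "disagreement V \<sigma>\<^sub>1 \<sigma>\<^sub>2 (g * h) \<subseteq> ?B \<union> disagreement V \<sigma>\<^sub>1 \<sigma>\<^sub>2 h"
    using hom_in[OF \<sigma>(1)] by (auto simp: disagreement_def hom_mult[OF \<sigma>(1)] hom_mult[OF \<sigma>(2)])
  then have "card (disagreement V \<sigma>\<^sub>1 \<sigma>\<^sub>2 (g * h)) \<le> card (?B \<union> disagreement V \<sigma>\<^sub>1 \<sigma>\<^sub>2 h)"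
    by (rule card_mono[rotated]) (use V in \<open>simp add: disagreement_def\<close>)
  also have "\<dots> \<le> card ?B + card (disagreement V \<sigma>\<^sub>1 \<sigma>\<^sub>2 h)" by (rule card_Un_le)
  also have "card ?B \<le> card (disagreement V \<sigma>\<^sub>1 \<sigma>\<^sub>2 g)"
    by (rule card_inj_on_le[of "\<sigma>\<^sub>1 h"])
      (use finite_disagreement[OF V] permutes_inj[OF hom_permutes[OF \<sigma>(1)]]
        in \<open>auto intro: inj_on_subset[OF _ subset_UNIV]\<close>)
  finally show ?thesis by simp
qed

text \<open>
  If the two actions of the inverse of \<open>g\<close> differ at \<open>v\<close>, then those of \<open>g\<close> differ at the first of
  the two preimages.
\<close>

lemma card_disagreement_inverse_le:
  fixes \<sigma>\<^sub>1 :: "'s::finite free_group \<Rightarrow> 'v \<Rightarrow> 'v"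
  assumes V: "finite V" and \<sigma>: "\<sigma>\<^sub>1 \<in> Homs V" "\<sigma>\<^sub>2 \<in> Homs V"
  shows "card (disagreement V \<sigma>\<^sub>1 \<sigma>\<^sub>2 (inverse g)) \<le> card (disagreement V \<sigma>\<^sub>1 \<sigma>\<^sub>2 g)"
proof (rule card_inj_on_le[of "\<sigma>\<^sub>1 (inverse g)"])
  show "inj_on (\<sigma>\<^sub>1 (inverse g)) (disagreement V \<sigma>\<^sub>1 \<sigma>\<^sub>2 (inverse g))"
    using permutes_inj[OF hom_permutes[OF \<sigma>(1)]] by (auto intro: inj_on_subset[OF _ subset_UNIV])
  show "\<sigma>\<^sub>1 (inverse g) ` disagreement V \<sigma>\<^sub>1 \<sigma>\<^sub>2 (inverse g) \<subseteq> disagreement V \<sigma>\<^sub>1 \<sigma>\<^sub>2 g"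
  proof (clarsimp simp: disagreement_def hom_in[OF \<sigma>(1)])
    fix v assume "\<sigma>\<^sub>1 (inverse g) v \<noteq> \<sigma>\<^sub>2 (inverse g) v"
      and eq: "\<sigma>\<^sub>1 g (\<sigma>\<^sub>1 (inverse g) v) = \<sigma>\<^sub>2 g (\<sigma>\<^sub>1 (inverse g) v)"
    moreover have "\<sigma>\<^sub>2 (inverse g) v = \<sigma>\<^sub>1 (inverse g) v"
      using hom_inverse(1)[OF \<sigma>(2), of g "\<sigma>\<^sub>1 (inverse g) v"] eq hom_inverse(2)[OF \<sigma>(1), of g v]
      by simp
    ultimately show False by simp
  qed
qed (rule finite_disagreement[OF V])

text \<open>
  Used with \<open>B = 0\<close> (generators determine a homomorphism) and \<open>B = 2\<close> (a single switching).
\<close>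

lemma card_disagreement_le:
  fixes \<sigma>\<^sub>1 :: "'s::finite free_group \<Rightarrow> 'v \<Rightarrow> 'v"
  assumes V: "finite V" and \<sigma>: "\<sigma>\<^sub>1 \<in> Homs V" "\<sigma>\<^sub>2 \<in> Homs V"
    and gens: "\<And>k. card (disagreement V \<sigma>\<^sub>1 \<sigma>\<^sub>2 (gen k)) \<le> B"
  shows "card (disagreement V \<sigma>\<^sub>1 \<sigma>\<^sub>2 g) \<le> B * word_length g"
proof -
  have words: "card (disagreement V \<sigma>\<^sub>1 \<sigma>\<^sub>2 (abs_free_group w)) \<le> B * length w" for w
  proof (induction w)
    case Nil
    then show ?case by (simp add: abs_free_group_Nil disagreement_def hom_one[OF \<sigma>(1)] hom_one[OF \<sigma>(2)])
  next
    case (Cons a w)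
    obtain k b where a: "a = (k, b)" by force
    let ?l = "if b then gen k else inverse (gen k)"
    have "card (disagreement V \<sigma>\<^sub>1 \<sigma>\<^sub>2 ?l) \<le> B"
      using gens[of k] card_disagreement_inverse_le[OF V \<sigma>, of "gen k"] by auto
    then show ?case
      using card_disagreement_mult_le[OF V \<sigma>, of ?l "abs_free_group w"] Cons.IH
      by (simp add: a abs_free_group_Cons)
  qed
  show ?thesis using words shortest_word[of g] by metis
qed

lemma hom_eqI:
  fixes \<sigma>\<^sub>1 :: "'s::finite free_group \<Rightarrow> 'v \<Rightarrow> 'v"
  assumes V: "finite V" and \<sigma>: "\<sigma>\<^sub>1 \<in> Homs V" "\<sigma>\<^sub>2 \<in> Homs V"
    and gens: "\<And>k v. v \<in> V \<Longrightarrow> \<sigma>\<^sub>1 (gen k) v = \<sigma>\<^sub>2 (gen k) v"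
  shows "\<sigma>\<^sub>1 = \<sigma>\<^sub>2"
proof (intro ext)
  fix g v
  have "disagreement V \<sigma>\<^sub>1 \<sigma>\<^sub>2 (gen k) = {}" for k
    using gens by (auto simp: disagreement_def)
  then have "disagreement V \<sigma>\<^sub>1 \<sigma>\<^sub>2 g = {}"
    using card_disagreement_le[OF V \<sigma>, of 0 g] finite_disagreement[OF V, of \<sigma>\<^sub>1 \<sigma>\<^sub>2 g] by simp
  moreover have "\<sigma>\<^sub>1 g v = \<sigma>\<^sub>2 g v" if "v \<notin> V"
    using permutes_not_in[OF hom_permutes[OF \<sigma>(1)] that] permutes_not_in[OF hom_permutes[OF \<sigma>(2)] that]
    by simp
  ultimately show "\<sigma>\<^sub>1 g v = \<sigma>\<^sub>2 g v" by (auto simp: disagreement_def)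
qed

lemma finite_Homs:
  assumes V: "finite V"
  shows "finite (Homs V :: ('s::finite free_group \<Rightarrow> 'v \<Rightarrow> 'v) set)"
proof (rule inj_on_finite)
  let ?g = "\<lambda>(\<sigma> :: 's free_group \<Rightarrow> 'v \<Rightarrow> 'v) k. \<sigma> (gen k)"
  show "inj_on ?g (Homs V)"
    by (rule inj_onI) (rule hom_eqI[OF V], auto dest: fun_cong)
  show "?g ` Homs V \<subseteq> UNIV \<rightarrow>\<^sub>E {p. p permutes V}"
    by (auto simp: hom_permutes)
  show "finite (UNIV \<rightarrow>\<^sub>E {p. p permutes V} :: ('s \<Rightarrow> 'v \<Rightarrow> 'v) set)"
    by (rule finite_PiE) (auto simp: finite_permutations V)
qed

fun eval_word :: "('s \<Rightarrow> 'v \<Rightarrow> 'v) \<Rightarrow> ('s \<times> bool) list \<Rightarrow> 'v \<Rightarrow> 'v" where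
  "eval_word p [] = id"
| "eval_word p ((k, b) # w) = (if b then p k else inv (p k)) \<circ> eval_word p w"

lemma eval_word_append: "eval_word p (u @ w) = eval_word p u \<circ> eval_word p w"
  by (induction p u rule: eval_word.induct) (simp_all add: comp_assoc)

lemma eval_word_cong:
  assumes bij: "\<And>k. bij (p k)" and "word_eq u w"
  shows "eval_word p u = eval_word p w"
  using assms(2)
proof (induction rule: equivclp_induct)
  case base
  then show ?case by simp
next
  case (step y z)
  have cancel: "eval_word p y = eval_word p z" if "cancel_step y z" for y z
    using that
  proof cases
    case (1 u k b v)
    have "p k \<circ> inv (p k) = id" "inv (p k) \<circ> p k = id"
      using bij[of k] by (auto simp: bij_def surj_iff inj_iff)
    then have "eval_word p ((k, b) # (k, \<not> b) # v) = eval_word p v"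
      by (cases b) (simp_all add: comp_assoc[symmetric])
    then show ?thesis unfolding 1 by (simp only: eval_word_append)
  qed
  from step cancel show ?case by metis
qed

text \<open>
  The universal property of the free group, needed to perform a prescribed switching.
\<close>

lemma ex_hom_with_generators:
  fixes p :: "'s \<Rightarrow> 'v \<Rightarrow> 'v"
  assumes p: "\<And>k. p k permutes V"
  shows "\<exists>\<sigma>\<in>Homs V. \<forall>k. \<sigma> (gen k) = p k"
proof (intro bexI allI)
  let ?\<sigma> = "\<lambda>g. eval_word p (rep_free_group g)"
  have abs: "?\<sigma> (abs_free_group w) = eval_word p w" for w
    by (rule eval_word_cong[OF permutes_bij[OF p]])
      (meson Quotient3_free_group Quotient3_rep_abs equivclp_refl rep_abs_rsp equivclp_sym)
  show "?\<sigma> (gen k) = p k" for k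
    by (simp add: gen.abs_eq abs)
  have perm: "eval_word p w permutes V" for w
  proof (induction w)
    case Nil
    show ?case unfolding eval_word.simps by (rule permutes_id)
  next
    case (Cons a w)
    obtain k b where a: "a = (k, b)" by force
    have "(if b then p k else inv (p k)) permutes V" using p permutes_inv by auto
    with Cons show ?case unfolding a eval_word.simps by (rule permutes_compose)
  qed
  have "?\<sigma> (g * h) = ?\<sigma> g \<circ> ?\<sigma> h" for g h
  proof -
    obtain u w where "g = abs_free_group u" "h = abs_free_group w"
      using ex_abs_free_group by metis
    then show ?thesis by (simp add: times_free_group.abs_eq abs eval_word_append del: o_apply)
  qed
  with perm show "?\<sigma> \<in> Homs V" by (simp add: Homs_def)
qed

section \<open>Switchings\<close>

text \<open>
  Choose a generator and a point \<open>v\<close> at which the two homomorphisms differ, and let \<open>w\<close> be the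
  point that \<open>\<sigma>\<^sub>1\<close> sends where \<open>\<sigma>\<^sub>2\<close> sends \<open>v\<close>.  Switching the images of \<open>v\<close> and \<open>w\<close> repairs \<open>v\<close>, and
  spoils nothing because \<open>w\<close> was wrong before.  So the number of disagreements on generators
  decreases.  Without such a path the minimum in the definition of the distance would be
  meaningless, and Lipschitz estimates could not be checked one switching at a time.
\<close>

lemma homs_joined_by_switchings:
  fixes \<sigma>\<^sub>1 :: "'s::finite free_group \<Rightarrow> 'v \<Rightarrow> 'v"
  assumes V: "finite V" and \<sigma>: "\<sigma>\<^sub>1 \<in> Homs V" "\<sigma>\<^sub>2 \<in> Homs V"
  shows "\<exists>m. (differ_by_switching V ^^ m) \<sigma>\<^sub>1 \<sigma>\<^sub>2"
  using \<sigma>(1)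
proof (induction "\<Sum>k\<in>UNIV. card (disagreement V \<sigma>\<^sub>1 \<sigma>\<^sub>2 (gen k))" arbitrary: \<sigma>\<^sub>1 rule: less_induct)
  case less
  note \<sigma>1 = less.prems
  show ?case
  proof (cases "\<exists>k. \<exists>v\<in>V. \<sigma>\<^sub>1 (gen k) v \<noteq> \<sigma>\<^sub>2 (gen k) v")
    case False
    then have "\<sigma>\<^sub>1 = \<sigma>\<^sub>2" by (intro hom_eqI[OF V \<sigma>1 \<sigma>(2)]) auto
    then have "(differ_by_switching V ^^ 0) \<sigma>\<^sub>1 \<sigma>\<^sub>2" by simp
    then show ?thesis by blast
  next
    case True
    then obtain k v where v: "v \<in> V" "\<sigma>\<^sub>1 (gen k) v \<noteq> \<sigma>\<^sub>2 (gen k) v" by blast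
    define w where "w = \<sigma>\<^sub>1 (inverse (gen k)) (\<sigma>\<^sub>2 (gen k) v)"
    have w: "w \<in> V" "\<sigma>\<^sub>1 (gen k) w = \<sigma>\<^sub>2 (gen k) v"
      unfolding w_def using v hom_in[OF \<sigma>1] hom_in[OF \<sigma>(2)] hom_inverse(2)[OF \<sigma>1] by auto
    then have wv: "w \<noteq> v" using v by auto
    define p where "p l = (if l = k then \<sigma>\<^sub>1 (gen k) \<circ> Transposition.transpose v w else \<sigma>\<^sub>1 (gen l))" for l
    have "p l permutes V" for l
      using hom_permutes[OF \<sigma>1] permutes_swap_id[OF v(1) w(1)]
      by (auto simp: p_def intro: permutes_compose)
    then obtain \<sigma>' where \<sigma>': "\<sigma>' \<in> Homs V" "\<And>l. \<sigma>' (gen l) = p l"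
      using ex_hom_with_generators by metis
    have sw: "differ_by_switching V \<sigma>\<^sub>1 \<sigma>'"
      unfolding differ_by_switching_def
      by (intro conjI \<sigma>1 \<sigma>'(1) bexI[OF _ v(1)] bexI[OF _ w(1)] exI[of _ k])
        (auto simp: \<sigma>'(2) p_def Transposition.transpose_def)
    have w2: "\<sigma>\<^sub>2 (gen k) w \<noteq> \<sigma>\<^sub>1 (gen k) w"
      using wv permutes_inj[OF hom_permutes[OF \<sigma>(2)]] w(2) by (auto simp: inj_eq)
    have k_sub: "disagreement V \<sigma>' \<sigma>\<^sub>2 (gen k) \<subseteq> disagreement V \<sigma>\<^sub>1 \<sigma>\<^sub>2 (gen k) - {v}"
    proof
      fix x assume x: "x \<in> disagreement V \<sigma>' \<sigma>\<^sub>2 (gen k)"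
      have at_v: "\<sigma>' (gen k) v = \<sigma>\<^sub>2 (gen k) v" by (simp add: \<sigma>'(2) p_def w(2))
      consider "x = v" | "x = w" | "x \<noteq> v" "x \<noteq> w" by blast
      then show "x \<in> disagreement V \<sigma>\<^sub>1 \<sigma>\<^sub>2 (gen k) - {v}"
      proof cases
        case 1
        then show ?thesis using x at_v by (simp add: disagreement_def)
      next
        case 2
        then show ?thesis using w(1) w2[symmetric] wv by (simp add: disagreement_def)
      next
        case 3
        then show ?thesis using x by (simp add: disagreement_def \<sigma>'(2) p_def)
      qed
    qed
    have "(\<Sum>k\<in>UNIV. card (disagreement V \<sigma>' \<sigma>\<^sub>2 (gen k))) < (\<Sum>k\<in>UNIV. card (disagreement V \<sigma>\<^sub>1 \<sigma>\<^sub>2 (gen k)))"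
    proof (rule sum_strict_mono_ex1)
      have lt: "card (disagreement V \<sigma>' \<sigma>\<^sub>2 (gen k)) < card (disagreement V \<sigma>\<^sub>1 \<sigma>\<^sub>2 (gen k))"
        using k_sub v by (intro psubset_card_mono finite_disagreement[OF V]) (auto simp: disagreement_def)
      then show "\<exists>l\<in>UNIV. card (disagreement V \<sigma>' \<sigma>\<^sub>2 (gen l)) < card (disagreement V \<sigma>\<^sub>1 \<sigma>\<^sub>2 (gen l))"
        by blast
      show "\<forall>l\<in>UNIV. card (disagreement V \<sigma>' \<sigma>\<^sub>2 (gen l)) \<le> card (disagreement V \<sigma>\<^sub>1 \<sigma>\<^sub>2 (gen l))"
      proof
        fix l
        show "card (disagreement V \<sigma>' \<sigma>\<^sub>2 (gen l)) \<le> card (disagreement V \<sigma>\<^sub>1 \<sigma>\<^sub>2 (gen l))"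
          using lt by (cases "l = k") (simp_all add: disagreement_def \<sigma>'(2) p_def)
      qed
    qed simp
    from less.hyps[OF this \<sigma>'(1)] obtain m where "(differ_by_switching V ^^ m) \<sigma>' \<sigma>\<^sub>2" by blast
    with sw have "(differ_by_switching V ^^ Suc m) \<sigma>\<^sub>1 \<sigma>\<^sub>2"
      by (rule relpowp_Suc_I2)
    then show ?thesis by blast
  qed
qed

text \<open>
  Lipschitz functions on homomorphisms are recognised on single switchings, by summing along a
  shortest path.
\<close>

lemma hom_lipschitzI:
  fixes f :: "('s::finite free_group \<Rightarrow> 'v \<Rightarrow> 'v) \<Rightarrow> real"
  assumes V: "finite V" and \<sigma>: "\<sigma>\<^sub>1 \<in> Homs V" "\<sigma>\<^sub>2 \<in> Homs V"
    and step: "\<And>\<sigma> \<sigma>'. differ_by_switching V \<sigma> \<sigma>' \<Longrightarrow> \<bar>f \<sigma> - f \<sigma>'\<bar> \<le> 1 / real (card V)"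
  shows "\<bar>f \<sigma>\<^sub>1 - f \<sigma>\<^sub>2\<bar> \<le> hom_dist V \<sigma>\<^sub>1 \<sigma>\<^sub>2"
proof -
  have path: "\<bar>f \<sigma>\<^sub>1 - f \<sigma>'\<bar> \<le> real m / real (card V)" if "(differ_by_switching V ^^ m) \<sigma>\<^sub>1 \<sigma>'" for m \<sigma>'
    using that
  proof (induction m arbitrary: \<sigma>')
    case 0
    then show ?case by simp
  next
    case (Suc m)
    then obtain \<sigma> where "(differ_by_switching V ^^ m) \<sigma>\<^sub>1 \<sigma>" "differ_by_switching V \<sigma> \<sigma>'" by auto
    then have "\<bar>f \<sigma>\<^sub>1 - f \<sigma>\<bar> \<le> real m / real (card V)" "\<bar>f \<sigma> - f \<sigma>'\<bar> \<le> 1 / real (card V)"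
      using Suc.IH step by auto
    then show ?case by (simp add: add_divide_distrib)
  qed
  show ?thesis unfolding hom_dist_def
    by (rule path, rule LeastI_ex, rule homs_joined_by_switchings[OF V \<sigma>])
qed

section \<open>Empirical measures\<close>

lemma pullback_name_measurable: "pullback_name \<sigma> x \<in> uniform_count_measure V \<rightarrow>\<^sub>M borel"
  by (simp add: measurable_def sets_uniform_count_measure space_uniform_count_measure)

lemma empirical_borel_probs:
  fixes \<sigma> :: "'s::finite free_group \<Rightarrow> 'v \<Rightarrow> 'v" and x :: "'v \<Rightarrow> 'a::{finite, discrete_topology}"
  assumes "finite V" "V \<noteq> {}"
  shows "empirical V \<sigma> x \<in> borel_probs"
  unfolding borel_probs_def empirical_def
  by (auto intro!: prob_space.prob_space_distr prob_space_uniform_count_measure assms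
      pullback_name_measurable)

lemma integral_empirical:
  fixes f :: "('s::finite free_group \<Rightarrow> 'a::{finite, discrete_topology}) \<Rightarrow> real"
  assumes "finite V" "shift_lipschitz f"
  shows "(\<integral>y. f y \<partial>empirical V \<sigma> x) = (\<Sum>v\<in>V. f (pullback_name \<sigma> x v)) / real (card V)"
  unfolding empirical_def
  by (subst integral_distr)
    (auto intro: borel_measurable_continuous_onI[OF shift_lipschitz_continuous[OF assms(2)]]
      simp: integral_uniform_count_measure[OF assms(1)] pullback_name_measurable)

lemma transport_dist_empirical_le:
  fixes \<sigma>\<^sub>1 \<sigma>\<^sub>2 :: "'s::finite free_group \<Rightarrow> 'v \<Rightarrow> 'v" and x :: "'v \<Rightarrow> 'a::{finite, discrete_topology}"
  assumes V: "finite V"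
  shows "transport_dist (empirical V \<sigma>\<^sub>1 x) (empirical V \<sigma>\<^sub>2 x)
    \<le> (\<Sum>v\<in>V. shift_dist (pullback_name \<sigma>\<^sub>1 x v) (pullback_name \<sigma>\<^sub>2 x v)) / real (card V)"
proof (rule transport_dist_least)
  fix f :: "('s free_group \<Rightarrow> 'a) \<Rightarrow> real"
  assume f: "shift_lipschitz f"
  have "\<bar>(\<Sum>v\<in>V. f (pullback_name \<sigma>\<^sub>1 x v)) - (\<Sum>v\<in>V. f (pullback_name \<sigma>\<^sub>2 x v))\<bar>
      \<le> (\<Sum>v\<in>V. \<bar>f (pullback_name \<sigma>\<^sub>1 x v) - f (pullback_name \<sigma>\<^sub>2 x v)\<bar>)"
    unfolding sum_subtractf[symmetric] by (rule sum_abs)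
  also have "\<dots> \<le> (\<Sum>v\<in>V. shift_dist (pullback_name \<sigma>\<^sub>1 x v) (pullback_name \<sigma>\<^sub>2 x v))"
    using f by (intro sum_mono) (simp add: shift_lipschitz_def)
  finally show "\<bar>(\<integral>y. f y \<partial>empirical V \<sigma>\<^sub>1 x) - (\<integral>y. f y \<partial>empirical V \<sigma>\<^sub>2 x)\<bar>
      \<le> (\<Sum>v\<in>V. shift_dist (pullback_name \<sigma>\<^sub>1 x v) (pullback_name \<sigma>\<^sub>2 x v)) / real (card V)"
    by (simp add: integral_empirical[OF V f] diff_divide_distrib[symmetric] divide_right_mono)
qed

lemma sum_infsum_swap:
  fixes f :: "'v \<Rightarrow> 'g \<Rightarrow> real"
  assumes "finite V" "\<And>v. v \<in> V \<Longrightarrow> f v summable_on A"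
  shows "(\<lambda>g. \<Sum>v\<in>V. f v g) summable_on A \<and> (\<Sum>v\<in>V. infsum (f v) A) = (\<Sum>\<^sub>\<infinity>g\<in>A. \<Sum>v\<in>V. f v g)"
  using assms by (induction V rule: finite_induct) (auto simp: infsum_add summable_on_add)

text \<open>
  A switching changes the action of an element \<open>g\<close> at no more than \<open>2 * word_length g\<close> points.
  Hence it changes the configurations seen from the points of \<open>V\<close> by a total of no more than
  \<open>\<Sum>\<^sub>g 2 * word_length g * weight g\<close>, a finite constant depending only on the rank, and the
  average over \<open>V\<close> divides this by the number of points.
\<close>

lemma switching_moves_empirical:
  obtains c :: real where "c > 0"
    "\<And>(V :: 'v set) (\<sigma>\<^sub>1 :: 's::finite free_group \<Rightarrow> 'v \<Rightarrow> 'v) \<sigma>\<^sub>2 (x :: 'v \<Rightarrow> 'a::{finite, discrete_topology}).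
      finite V \<Longrightarrow> differ_by_switching V \<sigma>\<^sub>1 \<sigma>\<^sub>2 \<Longrightarrow>
      transport_dist (empirical V \<sigma>\<^sub>1 x) (empirical V \<sigma>\<^sub>2 x) \<le> c / real (card V)"
proof
  let ?w = "\<lambda>g :: 's free_group. 2 * ((1 + real (word_length g)) * weight g)"
  have w: "?w summable_on UNIV"
    using summable_length_weight by (rule summable_on_cmult_right)
  \<comment> \<open>The constant is increased by 1 to make it positive, so that one may divide by it.\<close>
  have "infsum ?w UNIV \<ge> 0"
    by (rule infsum_nonneg) (simp add: less_imp_le[OF weight_pos])
  then show "infsum ?w UNIV + 1 > 0" by simp
  fix V :: "'v set" and \<sigma>\<^sub>1 \<sigma>\<^sub>2 :: "'s free_group \<Rightarrow> 'v \<Rightarrow> 'v" and x :: "'v \<Rightarrow> 'a"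
  assume V: "finite V" and sw: "differ_by_switching V \<sigma>\<^sub>1 \<sigma>\<^sub>2"
  from sw obtain i j k where \<sigma>: "\<sigma>\<^sub>1 \<in> Homs V" "\<sigma>\<^sub>2 \<in> Homs V"
    and eq: "\<forall>l. \<forall>v\<in>V. \<not> (l = k \<and> v \<in> {i, j}) \<longrightarrow> \<sigma>\<^sub>1 (gen l) v = \<sigma>\<^sub>2 (gen l) v"
    unfolding differ_by_switching_def by blast
  have "card (disagreement V \<sigma>\<^sub>1 \<sigma>\<^sub>2 (gen l)) \<le> 2" for l
  proof -
    have "disagreement V \<sigma>\<^sub>1 \<sigma>\<^sub>2 (gen l) \<subseteq> {i, j}" using eq by (auto simp: disagreement_def)
    then have "card (disagreement V \<sigma>\<^sub>1 \<sigma>\<^sub>2 (gen l)) \<le> card {i, j}" by (rule card_mono[rotated]) simp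
    also have "\<dots> \<le> 2" by (simp add: card_insert_if)
    finally show ?thesis .
  qed
  then have dis: "card (disagreement V \<sigma>\<^sub>1 \<sigma>\<^sub>2 g) \<le> 2 * word_length g" for g
    by (rule card_disagreement_le[OF V \<sigma>])
  let ?f = "\<lambda>v g. of_bool (pullback_name \<sigma>\<^sub>1 x v g \<noteq> pullback_name \<sigma>\<^sub>2 x v g) * weight g"
  have swap: "(\<lambda>g. \<Sum>v\<in>V. ?f v g) summable_on UNIV \<and> (\<Sum>v\<in>V. infsum (?f v) UNIV) = (\<Sum>\<^sub>\<infinity>g. \<Sum>v\<in>V. ?f v g)"
    by (rule sum_infsum_swap[OF V summable_disagreement])
  have "(\<Sum>v\<in>V. shift_dist (pullback_name \<sigma>\<^sub>1 x v) (pullback_name \<sigma>\<^sub>2 x v)) = (\<Sum>\<^sub>\<infinity>g. \<Sum>v\<in>V. ?f v g)"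
    using swap by (simp add: shift_dist_weight)
  also have "\<dots> \<le> infsum ?w UNIV"
  proof (rule infsum_mono[OF conjunct1[OF swap] w])
    fix g :: "'s free_group"
    have "(\<Sum>v\<in>V. ?f v g) \<le> (\<Sum>v\<in>V. of_bool (v \<in> disagreement V \<sigma>\<^sub>1 \<sigma>\<^sub>2 g) * weight g)"
      by (rule sum_mono) (auto simp: disagreement_def pullback_name_def less_imp_le[OF weight_pos])
    also have "\<dots> = real (card (disagreement V \<sigma>\<^sub>1 \<sigma>\<^sub>2 g)) * weight g"
      using V by (simp add: sum_distrib_right[symmetric] disagreement_def Int_def)
    also have "\<dots> \<le> (2 * (1 + real (word_length g))) * weight g"
      using dis[of g] by (intro mult_right_mono) (auto simp: less_imp_le[OF weight_pos])
    finally show "(\<Sum>v\<in>V. ?f v g) \<le> ?w g" by (simp only: mult.assoc)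
  qed
  finally have "(\<Sum>v\<in>V. shift_dist (pullback_name \<sigma>\<^sub>1 x v) (pullback_name \<sigma>\<^sub>2 x v)) \<le> infsum ?w UNIV + 1"
    by simp
  then show "transport_dist (empirical V \<sigma>\<^sub>1 x) (empirical V \<sigma>\<^sub>2 x) \<le> (infsum ?w UNIV + 1) / real (card V)"
    using transport_dist_empirical_le[OF V, of \<sigma>\<^sub>1 x \<sigma>\<^sub>2] by (meson divide_right_mono of_nat_0_le_iff order_trans)
qed

section \<open>Transportation balls are weak neighbourhoods\<close>

lemma locally_determined_continuous:
  fixes f :: "('g \<Rightarrow> 'a::discrete_topology) \<Rightarrow> 'c::topological_space"
  assumes F: "finite F" and f: "\<And>x y. (\<forall>g\<in>F. x g = y g) \<Longrightarrow> f x = f y"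
  shows "continuous_on UNIV f"
  unfolding continuous_on_def
proof (rule ballI, rule tendsto_eventually)
  fix x :: "'g \<Rightarrow> 'a"
  show "\<forall>\<^sub>F y in at x. f y = f x"
    unfolding eventually_at_topological
  proof (intro exI[of _ "cylinder F x"] conjI ballI impI)
    show "f y = f x" if "y \<in> cylinder F x" for y
      using that by (intro f) (simp add: cylinder_def)
  qed (simp_all add: open_cylinder F, simp add: cylinder_def)
qed

lemma topspace_weak_topology: "topspace weak_topology = Prob_inv"
proof -
  have "Prob_inv \<in> {{\<mu> \<in> Prob_inv. (\<integral>x. f x \<partial>\<mu>) \<in> U} |
      (f :: ('a free_group \<Rightarrow> 'b) \<Rightarrow> real) U. continuous_on UNIV f \<and> open U}"
    by (rule CollectI, rule exI[of _ "\<lambda>_. 0"], rule exI[of _ UNIV]) simp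
  then show ?thesis
    unfolding weak_topology_def topology_generated_by_topspace by blast
qed

text \<open>
  A 1-Lipschitz function is determined, up to a small error that does not depend on the function,
  by its values on the finitely many patterns on a large finite set \<open>F\<close>.  After subtracting a
  constant these values are bounded, so measures that give nearly the same mass to each of the
  finitely many cylinders over \<open>F\<close> are close in the transportation distance.
\<close>

lemma weak_neighbourhood_in_transport_ball:
  fixes \<mu> :: "('s::finite free_group \<Rightarrow> 'a::{finite, discrete_topology}) measure"
  assumes \<mu>: "\<mu> \<in> Prob_inv" and \<epsilon>: "\<epsilon> > 0"
  shows "\<exists>T. openin weak_topology T \<and> \<mu> \<in> T \<and> (\<forall>\<nu>\<in>T. transport_dist \<nu> \<mu> < \<epsilon>)"
proof -
  obtain F :: "'s free_group set" where F: "finite F"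
    "\<And>x y :: 's free_group \<Rightarrow> 'a. (\<forall>g\<in>F. x g = y g) \<Longrightarrow> shift_dist x y < \<epsilon> / 8"
    using shift_dist_small_if_agree[of "\<epsilon> / 8"] \<epsilon> by auto
  \<comment> \<open>A pattern on \<open>F\<close> is also read as a configuration, namely one that is constant outside \<open>F\<close>.\<close>
  define P :: "('s free_group \<Rightarrow> 'a) set" where "P = F \<rightarrow>\<^sub>E UNIV"
  define \<phi> :: "('s free_group \<Rightarrow> 'a) \<Rightarrow> ('s free_group \<Rightarrow> 'a) \<Rightarrow> real"
    where "\<phi> p x = of_bool (restrict x F = p)" for p x
  define D where "D = total_weight TYPE('s)"
  have P: "finite P" "P \<noteq> {}" unfolding P_def using F(1) by (auto intro!: finite_PiE simp: PiE_eq_empty_iff)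
  have rP: "restrict x F \<in> P" for x by (simp add: P_def)
  have D0: "D \<ge> 0" using shift_lipschitz_abs_le[of "\<lambda>_ :: 's free_group \<Rightarrow> 'a. 0"] shift_dist_nonneg
    by (auto simp: D_def shift_lipschitz_def)
  have cont: "continuous_on UNIV (\<phi> p)" for p
    by (rule locally_determined_continuous[OF F(1)]) (simp add: \<phi>_def cong: restrict_cong)
  have int: "integrable \<nu> (\<phi> p)" if "\<nu> \<in> borel_probs" for \<nu> p
  proof -
    interpret prob_space \<nu> using that by (simp add: borel_probs_def)
    have "\<phi> p \<in> borel_measurable \<nu>"
      using borel_measurable_continuous_onI[OF cont] that
      by (simp add: borel_probs_def cong: measurable_cong_sets)
    then show ?thesis by (rule integrable_const_bound[where B=1, rotated]) (simp add: \<phi>_def)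
  qed
  have one: "(\<Sum>p\<in>P. h p * \<phi> p x) = h (restrict x F)" for h :: "_ \<Rightarrow> real" and x
  proof -
    have "(\<Sum>p\<in>P. h p * \<phi> p x) = (\<Sum>p\<in>P. if restrict x F = p then h p else 0)"
      by (rule sum.cong) (auto simp: \<phi>_def)
    also have "\<dots> = h (restrict x F)" using P(1) rP[of x] by simp
    finally show ?thesis .
  qed
  have total: "(\<Sum>p\<in>P. \<integral>x. \<phi> p x \<partial>\<nu>) = 1" if "\<nu> \<in> borel_probs" for \<nu>
  proof -
    interpret prob_space \<nu> using that by (simp add: borel_probs_def)
    have "(\<Sum>p\<in>P. \<integral>x. \<phi> p x \<partial>\<nu>) = (\<integral>x. (\<Sum>p\<in>P. \<phi> p x) \<partial>\<nu>)"
      using int[OF that] by simp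
    also have "\<dots> = (\<integral>x. 1 \<partial>\<nu>)" using one[of "\<lambda>_. 1"] by simp
    finally show ?thesis by (simp add: prob_space)
  qed
  have approx: "\<bar>(\<integral>x. f x \<partial>\<nu>) - (\<Sum>p\<in>P. f p * (\<integral>x. \<phi> p x \<partial>\<nu>))\<bar> \<le> \<epsilon> / 8"
    if f: "shift_lipschitz f" and \<nu>: "\<nu> \<in> borel_probs" for f \<nu>
  proof -
    interpret prob_space \<nu> using \<nu> by (simp add: borel_probs_def)
    have i1: "integrable \<nu> (\<lambda>x. \<Sum>p\<in>P. f p * \<phi> p x)"
      using int[OF \<nu>] by (intro Bochner_Integration.integrable_sum integrable_mult_right) auto
    note i2 = Bochner_Integration.integrable_diff[OF shift_lipschitz_integrable[OF f \<nu>] i1]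
    have b: "\<bar>f x - (\<Sum>p\<in>P. f p * \<phi> p x)\<bar> \<le> \<epsilon> / 8" for x
    proof -
      have "\<bar>f x - f (restrict x F)\<bar> \<le> shift_dist x (restrict x F)"
        using f by (simp add: shift_lipschitz_def)
      also have "\<dots> < \<epsilon> / 8" by (rule F(2)) simp
      finally show ?thesis by (simp add: one)
    qed
    have "(\<integral>x. f x \<partial>\<nu>) - (\<Sum>p\<in>P. f p * (\<integral>x. \<phi> p x \<partial>\<nu>)) = (\<integral>x. f x - (\<Sum>p\<in>P. f p * \<phi> p x) \<partial>\<nu>)"
      using shift_lipschitz_integrable[OF f \<nu>] i1 int[OF \<nu>] by simp
    moreover have "(\<integral>x. f x - (\<Sum>p\<in>P. f p * \<phi> p x) \<partial>\<nu>) \<le> \<epsilon> / 8"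
      by (rule integral_le_const[OF i2 AE_I2]) (use b abs_le_D1 in blast)
    moreover have "- (\<epsilon> / 8) \<le> (\<integral>x. f x - (\<Sum>p\<in>P. f p * \<phi> p x) \<partial>\<nu>)"
    proof (rule integral_ge_const[OF i2 AE_I2])
      show "- (\<epsilon> / 8) \<le> f x - (\<Sum>p\<in>P. f p * \<phi> p x)" for x
        using b[of x] by linarith
    qed
    ultimately show ?thesis by linarith
  qed
  \<comment> \<open>With this bound on the mass defect of each of the \<open>card P\<close> cylinders, the total error is \<open>\<epsilon> / 4\<close>.\<close>
  define \<eta> where "\<eta> = \<epsilon> / (4 * (D + 1) * real (card P))"
  have cP: "real (card P) > 0" using P by (simp add: card_gt_0_iff)
  have \<eta>: "\<eta> > 0" unfolding \<eta>_def using \<epsilon> D0 cP by simp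
  define T where "T = (\<Inter>p\<in>P. {\<nu> \<in> Prob_inv. (\<integral>x. \<phi> p x \<partial>\<nu>) \<in> ball (\<integral>x. \<phi> p x \<partial>\<mu>) \<eta>})"
  have "openin weak_topology T"
    unfolding T_def
  proof (rule openin_INT2[OF P], unfold weak_topology_def, rule topology_generated_by_Basis)
    show "{\<nu> \<in> Prob_inv. (\<integral>x. \<phi> p x \<partial>\<nu>) \<in> ball (\<integral>x. \<phi> p x \<partial>\<mu>) \<eta>}
        \<in> {{\<mu> \<in> Prob_inv. (\<integral>x. f x \<partial>\<mu>) \<in> U} | (f :: _ \<Rightarrow> real) U. continuous_on UNIV f \<and> open U}" for p
      using cont[of p] by blast
  qed
  moreover have "\<mu> \<in> T" using \<mu> \<eta> by (simp add: T_def)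
  moreover have "transport_dist \<nu> \<mu> < \<epsilon>" if \<nu>: "\<nu> \<in> T" for \<nu>
  proof -
    have \<nu>P: "\<nu> \<in> Prob_inv" using \<nu> P(2) by (auto simp: T_def)
    note b\<mu> = Prob_inv_borel[OF \<mu>] and b\<nu> = Prob_inv_borel[OF \<nu>P]
    have "transport_dist \<nu> \<mu> \<le> \<epsilon> / 2"
    proof (rule transport_dist_least)
      fix f :: "('s free_group \<Rightarrow> 'a) \<Rightarrow> real"
      assume f: "shift_lipschitz f"
      let ?d = "\<lambda>p. (\<integral>x. \<phi> p x \<partial>\<nu>) - (\<integral>x. \<phi> p x \<partial>\<mu>)"
      \<comment> \<open>Both measures have total mass one, so a constant may be subtracted from \<open>f\<close>; only its oscillation enters.\<close>
      have zero: "(\<Sum>p\<in>P. ?d p) = 0" using total[OF b\<mu>] total[OF b\<nu>] by (simp add: sum_subtractf)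
      have "(\<Sum>p\<in>P. (f p - f undefined) * ?d p) = (\<Sum>p\<in>P. f p * ?d p) - f undefined * (\<Sum>p\<in>P. ?d p)"
        by (simp add: algebra_simps sum.distrib sum_subtractf sum_distrib_left)
      then have "(\<Sum>p\<in>P. f p * ?d p) = (\<Sum>p\<in>P. (f p - f undefined) * ?d p)"
        by (simp only: zero)
      also have "\<bar>\<dots>\<bar> \<le> (\<Sum>p\<in>P. (D + 1) * \<eta>)"
      proof (rule order_trans[OF sum_abs sum_mono])
        fix p assume "p \<in> P"
        then have "\<bar>?d p\<bar> \<le> \<eta>" using \<nu> by (auto simp: T_def dist_real_def abs_minus_commute less_imp_le)
        moreover have "\<bar>f p - f undefined\<bar> \<le> D + 1"
          using shift_lipschitz_abs_le[OF f, of p undefined] by (simp add: D_def)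
        ultimately show "\<bar>(f p - f undefined) * ?d p\<bar> \<le> (D + 1) * \<eta>"
          unfolding abs_mult by (intro mult_mono) (use D0 in auto)
      qed
      also have "\<dots> = \<epsilon> / 4"
      proof -
        have "4 * (D + 1) * real (card P) \<noteq> 0" using D0 cP by simp
        then have "\<eta> * (4 * (D + 1) * real (card P)) = \<epsilon>"
          using \<eta>_def nonzero_eq_divide_eq by blast
        then show ?thesis by (simp add: algebra_simps)
      qed
      finally have "\<bar>(\<Sum>p\<in>P. f p * (\<integral>x. \<phi> p x \<partial>\<nu>)) - (\<Sum>p\<in>P. f p * (\<integral>x. \<phi> p x \<partial>\<mu>))\<bar> \<le> \<epsilon> / 4"
        by (simp add: right_diff_distrib sum_subtractf)
      then show "\<bar>(\<integral>x. f x \<partial>\<nu>) - (\<integral>x. f x \<partial>\<mu>)\<bar> \<le> \<epsilon> / 2"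
        using approx[OF f b\<mu>] approx[OF f b\<nu>] by linarith
    qed
    then show ?thesis using \<epsilon> by simp
  qed
  ultimately show ?thesis by blast
qed

text \<open>
  The hypothesis says that moving the measure is compensated by doubling the scale; an infimum over
  scales then forgets the loss.
\<close>

lemma upper_semicontinuous_INF_scales:
  fixes \<Phi> :: "real \<Rightarrow> ('s::finite free_group \<Rightarrow> 'a::{finite, discrete_topology}) measure \<Rightarrow> ereal"
  assumes \<Phi>: "\<And>\<mu> \<nu> \<epsilon>. \<lbrakk>\<mu> \<in> Prob_inv; \<nu> \<in> Prob_inv; \<epsilon> > 0; transport_dist \<nu> \<mu> < \<epsilon>\<rbrakk> \<Longrightarrow> \<Phi> \<epsilon> \<nu> \<le> \<Phi> (2 * \<epsilon>) \<mu>"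
  shows "upper_semicontinuous_map weak_topology (\<lambda>\<mu>. INF \<epsilon>\<in>{0<..}. \<Phi> \<epsilon> \<mu>)"
  unfolding upper_semicontinuous_map_def topspace_weak_topology
proof (rule allI, subst openin_subopen, rule ballI)
  fix c \<mu> assume "\<mu> \<in> {\<mu> \<in> Prob_inv. (INF \<epsilon>\<in>{0<..}. \<Phi> \<epsilon> \<mu>) < c}"
  then have \<mu>: "\<mu> \<in> Prob_inv" and "(INF \<epsilon>\<in>{0<..}. \<Phi> \<epsilon> \<mu>) < c" by auto
  then obtain \<epsilon> where \<epsilon>: "\<epsilon> > 0" "\<Phi> \<epsilon> \<mu> < c" by (auto simp: INF_less_iff)
  obtain T where T: "openin weak_topology T" "\<mu> \<in> T" "\<And>\<nu>. \<nu> \<in> T \<Longrightarrow> transport_dist \<nu> \<mu> < \<epsilon> / 2"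
    using weak_neighbourhood_in_transport_ball[OF \<mu>, of "\<epsilon> / 2"] \<epsilon>(1) by auto
  have "T \<subseteq> {\<mu> \<in> Prob_inv. (INF \<epsilon>\<in>{0<..}. \<Phi> \<epsilon> \<mu>) < c}"
  proof
    fix \<nu> assume \<nu>: "\<nu> \<in> T"
    then have \<nu>P: "\<nu> \<in> Prob_inv"
      using openin_subset[OF T(1)] by (auto simp: topspace_weak_topology)
    have "(INF \<epsilon>\<in>{0<..}. \<Phi> \<epsilon> \<nu>) \<le> \<Phi> (\<epsilon> / 2) \<nu>" by (rule INF_lower) (use \<epsilon> in simp)
    also have "\<dots> \<le> \<Phi> \<epsilon> \<mu>" using \<Phi>[OF \<mu> \<nu>P _ T(3)[OF \<nu>]] \<epsilon> by simp
    finally show "\<nu> \<in> {\<mu> \<in> Prob_inv. (INF \<epsilon>\<in>{0<..}. \<Phi> \<epsilon> \<mu>) < c}" using \<epsilon>(2) \<nu>P by simp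
  qed
  with T show "\<exists>T. openin weak_topology T \<and> \<mu> \<in> T \<and> T \<subseteq> {\<mu> \<in> Prob_inv. (INF \<epsilon>\<in>{0<..}. \<Phi> \<epsilon> \<mu>) < c}"
    by blast
qed

section \<open>Exponential growth rates of model counts\<close>

lemma finite_good_models: "finite V \<Longrightarrow> finite (good_models V \<sigma> \<mu> \<epsilon>)"
  by (rule finite_subset[of _ "V \<rightarrow>\<^sub>E UNIV"]) (auto simp: good_models_def intro!: finite_PiE)

text \<open>
  Errors made by replacing the homomorphism and the target measure are both absorbed into the radius.
\<close>

lemma good_models_subset:
  fixes \<sigma> \<sigma>' :: "'s::finite free_group \<Rightarrow> 'v \<Rightarrow> 'v"
    and \<mu> \<nu> :: "('s free_group \<Rightarrow> 'a::{finite, discrete_topology}) measure"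
  assumes V: "finite V" "V \<noteq> {}" and \<mu>: "\<mu> \<in> borel_probs" "\<nu> \<in> borel_probs"
    and \<sigma>: "\<And>x :: 'v \<Rightarrow> 'a. transport_dist (empirical V \<sigma>' x) (empirical V \<sigma> x) \<le> s"
    and t: "transport_dist \<mu> \<nu> \<le> t" and \<epsilon>: "\<epsilon> + s + t \<le> \<epsilon>'"
  shows "good_models V \<sigma> \<mu> \<epsilon> \<subseteq> good_models V \<sigma>' \<nu> \<epsilon>'"
proof
  fix x assume x: "x \<in> good_models V \<sigma> \<mu> \<epsilon>"
  have e: "empirical V \<tau> x \<in> borel_probs" for \<tau> :: "'s free_group \<Rightarrow> 'v \<Rightarrow> 'v"
    by (rule empirical_borel_probs[OF V])
  show "x \<in> good_models V \<sigma>' \<nu> \<epsilon>'"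
    using x \<sigma>[of x] t \<epsilon> transport_dist_triangle[OF e e \<mu>(2), of \<sigma>' \<sigma>]
      transport_dist_triangle[OF e \<mu>, of \<sigma>]
    by (auto simp: good_models_def)
qed

lemma card_good_models_change_measure:
  assumes V: "finite V" "V \<noteq> {}" and \<mu>: "\<mu> \<in> borel_probs" "\<nu> \<in> borel_probs"
    and t: "transport_dist \<mu> \<nu> \<le> t" and \<epsilon>: "\<epsilon> + t \<le> \<epsilon>'"
  shows "card (good_models V \<sigma> \<mu> \<epsilon>) \<le> card (good_models V \<sigma> \<nu> \<epsilon>')"
  by (rule card_mono[OF finite_good_models[OF V(1)]],
      rule good_models_subset[OF V \<mu> transport_dist_refl t]) (use \<epsilon> in simp)

lemma exp_le_if_rate_greater:
  assumes "N > 0" "c \<ge> 0" "ereal a < elog c / ereal N"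
  shows "exp (a * N) \<le> c"
proof (cases "c = 0")
  case True
  then show ?thesis using assms by (simp add: elog_def)
next
  case False
  then have "a < ln c / N" using assms by (simp add: elog_def)
  then have "a * N \<le> ln c" using assms by (simp add: field_simps)
  then show ?thesis using False assms by (simp add: ln_ge_iff)
qed

lemma rate_ge_if_exp_le:
  assumes "N > 0" "exp (a * N) \<le> c"
  shows "ereal a \<le> elog c / ereal N"
proof -
  have "c > 0" using assms exp_gt_zero[of "a * N"] by linarith
  then show ?thesis using assms by (simp add: elog_def ln_ge_iff field_simps)
qed

abbreviation model_rate where
  "model_rate V \<sigma> \<mu> \<epsilon> \<equiv> elog (real (card (good_models V \<sigma> \<mu> \<epsilon>))) / ereal (real (card V))"

lemma elog_mono: "0 \<le> a \<Longrightarrow> a \<le> b \<Longrightarrow> elog a \<le> elog b"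
  by (simp add: elog_def)

lemma model_rate_change_measure:
  assumes V: "finite V" "V \<noteq> {}" and \<mu>: "\<mu> \<in> borel_probs" "\<nu> \<in> borel_probs"
    and t: "transport_dist \<mu> \<nu> \<le> t" and \<epsilon>: "\<epsilon> + t \<le> \<epsilon>'"
  shows "model_rate V \<sigma> \<mu> \<epsilon> \<le> model_rate V \<sigma> \<nu> \<epsilon>'"
  using V card_good_models_change_measure[OF assms, of \<sigma>]
  by (intro ereal_divide_right_mono elog_mono) (auto simp: card_gt_0_iff)

abbreviation (input) entropy_range :: "real \<Rightarrow> ereal set" where
  "entropy_range L \<equiv> {-\<infinity>} \<union> {0..ereal L}"

lemma model_rate_range:
  fixes \<mu> :: "('s::finite free_group \<Rightarrow> 'a::{finite, discrete_topology}) measure"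
  assumes V: "finite V" "V \<noteq> {}"
  shows "model_rate V \<sigma> \<mu> \<epsilon> \<in> entropy_range (ln (real CARD('a)))"
proof -
  let ?c = "card (good_models V \<sigma> \<mu> \<epsilon>)"
  have N: "real (card V) > 0" using V by (simp add: card_gt_0_iff)
  have A: "real CARD('a) > 0" by (simp add: card_gt_0_iff)
  have "?c \<le> card (V \<rightarrow>\<^sub>E (UNIV :: 'a set))"
    by (rule card_mono) (auto simp: good_models_def V intro!: finite_PiE)
  then have le: "?c \<le> CARD('a) ^ card V" using V by (simp add: card_funcsetE)
  show ?thesis
  proof (cases "?c = 0")
    case True
    then show ?thesis using N by (simp add: elog_def)
  next
    case False
    have "ln (real ?c) \<le> ln (real CARD('a) ^ card V)"
      using False le A by (intro ln_mono) (auto simp flip: of_nat_power)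
    also have "\<dots> = real (card V) * ln (real CARD('a))" using A by (simp add: ln_realpow)
    finally have "ln (real ?c) / real (card V) \<le> ln (real CARD('a))" using N by (simp add: field_simps)
    then show ?thesis using False N by (simp add: elog_def)
  qed
qed

lemma frequently_le_Limsup:
  fixes u :: "nat \<Rightarrow> ereal"
  assumes "\<exists>\<^sub>F n in sequentially. a \<le> u n" shows "a \<le> limsup u"
proof (rule ccontr)
  assume "\<not> a \<le> limsup u"
  then have "\<forall>\<^sub>F n in sequentially. u n < a" by (simp add: Limsup_lessD not_le)
  with assms show False by (auto simp: frequently_def not_le elim: eventually_mono)
qed

lemma less_limsup_frequently:
  fixes u :: "nat \<Rightarrow> ereal"
  assumes "a < limsup u" shows "\<exists>\<^sub>F n in sequentially. a < u n"
proof (rule ccontr)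
  assume "\<not> (\<exists>\<^sub>F n in sequentially. a < u n)"
  then have "\<forall>\<^sub>F n in sequentially. u n \<le> a" by (simp add: frequently_def not_less)
  then have "limsup u \<le> a" by (rule Limsup_bounded)
  with assms show False by simp
qed

text \<open>
  There is a gap between \<open>-\<infinity>\<close> and \<open>0\<close>: a nonempty set of models has at least one element.  This gap
  survives upper and lower limits and the infimum over scales.
\<close>

lemma limsup_in_range:
  assumes u: "\<And>n. u n \<in> entropy_range L" shows "limsup u \<in> entropy_range L"
proof (cases "limsup u = -\<infinity>")
  case False
  then have "\<exists>\<^sub>F n in sequentially. -\<infinity> < u n" by (intro less_limsup_frequently) auto
  then have "\<exists>\<^sub>F n in sequentially. 0 \<le> u n"
    by (rule frequently_elim1) (use u in force)
  moreover have "u n \<le> ereal L" for n using u[of n] by auto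
  ultimately show ?thesis
    using frequently_le_Limsup[of 0 u] by (auto intro!: Limsup_bounded)
qed simp

lemma liminf_in_range:
  assumes u: "\<And>n. u n \<in> entropy_range L" shows "liminf u \<in> entropy_range L"
proof (cases "liminf u = -\<infinity>")
  case False
  then have "\<forall>\<^sub>F n in sequentially. -\<infinity> < u n" by (intro less_LiminfD) auto
  then have "\<forall>\<^sub>F n in sequentially. 0 \<le> u n"
    by (rule eventually_mono) (use u in force)
  then have "0 \<le> liminf u" by (rule Liminf_bounded)
  moreover have "u n \<le> ereal L" for n using u[of n] by auto
  then have "limsup u \<le> ereal L" by (auto intro!: Limsup_bounded)
  ultimately show ?thesis
    using Liminf_le_Limsup[of sequentially u] by (auto intro: order_trans)
qed simp

lemma INF_scales_in_range:
  fixes \<Phi> :: "real \<Rightarrow> ereal"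
  assumes \<Phi>: "\<And>\<epsilon>. \<epsilon> > 0 \<Longrightarrow> \<Phi> \<epsilon> \<in> entropy_range L"
  shows "(INF \<epsilon>\<in>{0<..}. \<Phi> \<epsilon>) \<in> entropy_range L"
proof (cases "(INF \<epsilon>\<in>{0<..}. \<Phi> \<epsilon>) = -\<infinity>")
  case False
  have "0 \<le> \<Phi> \<epsilon>" if "\<epsilon> > 0" for \<epsilon>
  proof -
    have "(INF \<epsilon>\<in>{0<..}. \<Phi> \<epsilon>) \<le> \<Phi> \<epsilon>" by (rule INF_lower) (use that in simp)
    then have "\<Phi> \<epsilon> \<noteq> -\<infinity>" using False by auto
    then show ?thesis using \<Phi>[OF that] by auto
  qed
  then have "0 \<le> (INF \<epsilon>\<in>{0<..}. \<Phi> \<epsilon>)" by (auto intro: INF_greatest)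
  moreover have "(INF \<epsilon>\<in>{0<..}. \<Phi> \<epsilon>) \<le> ereal L"
    by (rule INF_lower2[of 1]) (use \<Phi>[of 1] in auto)
  ultimately show ?thesis by auto
qed simp

section \<open>The model radius and the comparison of entropies\<close>

text \<open>
  The least radius at which there are at least \<open>exp (a |V|)\<close> models.  The alternative \<open>1 \<le> \<epsilon>\<close> caps
  the radius at 1, so that the infimum is taken over a nonempty set even when \<open>a\<close> exceeds the
  logarithm of the alphabet size.
\<close>

definition model_radius ::
  "'v set \<Rightarrow> ('s::finite free_group \<Rightarrow> 'a::{finite, discrete_topology}) measure \<Rightarrow> real
    \<Rightarrow> ('s free_group \<Rightarrow> 'v \<Rightarrow> 'v) \<Rightarrow> real" where
  "model_radius V \<mu> a \<sigma> =
    Inf {\<epsilon>. \<epsilon> > 0 \<and> (1 \<le> \<epsilon> \<or> exp (a * real (card V)) \<le> real (card (good_models V \<sigma> \<mu> \<epsilon>)))}"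

lemma model_radius_le:
  assumes "\<epsilon> > 0" "1 \<le> \<epsilon> \<or> exp (a * real (card V)) \<le> real (card (good_models V \<sigma> \<mu> \<epsilon>))"
  shows "model_radius V \<mu> a \<sigma> \<le> \<epsilon>"
  unfolding model_radius_def
  by (rule cInf_lower) (use assms in \<open>auto intro: bdd_belowI[of _ 0]\<close>)

lemma model_radius_less:
  assumes V: "finite V" "V \<noteq> {}" and \<mu>: "\<mu> \<in> borel_probs"
    and \<epsilon>: "model_radius V \<mu> a \<sigma> < \<epsilon>" "\<epsilon> \<le> 1"
  shows "exp (a * real (card V)) \<le> real (card (good_models V \<sigma> \<mu> \<epsilon>))"
proof -
  let ?E = "{\<epsilon>. \<epsilon> > 0 \<and> (1 \<le> \<epsilon> \<or> exp (a * real (card V)) \<le> real (card (good_models V \<sigma> \<mu> \<epsilon>)))}"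
  have "?E \<noteq> {}" by (auto intro: exI[of _ 1])
  then obtain \<delta> where "\<delta> < \<epsilon>" "exp (a * real (card V)) \<le> real (card (good_models V \<sigma> \<mu> \<delta>))"
    using cInf_lessD[of ?E \<epsilon>] \<epsilon> unfolding model_radius_def by fastforce
  moreover have "card (good_models V \<sigma> \<mu> \<delta>) \<le> card (good_models V \<sigma> \<mu> \<epsilon>)" if "\<delta> < \<epsilon>"
    by (rule card_good_models_change_measure[OF V \<mu> \<mu> transport_dist_refl]) (use that in simp)
  ultimately show ?thesis by fastforce
qed

text \<open>
  The number of models at a fixed radius may react wildly to a small change of the homomorphism.
  The radius that achieves a fixed number of models does not: enlarging it by the displacement
  of the empirical measures keeps all the models.
\<close>

lemma model_radius_change_hom:
  fixes \<sigma> \<sigma>' :: "'s::finite free_group \<Rightarrow> 'v \<Rightarrow> 'v"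
    and \<mu> :: "('s free_group \<Rightarrow> 'a::{finite, discrete_topology}) measure"
  assumes V: "finite V" "V \<noteq> {}" and \<mu>: "\<mu> \<in> borel_probs" and s: "s \<ge> 0"
    and \<sigma>: "\<And>x :: 'v \<Rightarrow> 'a. transport_dist (empirical V \<sigma>' x) (empirical V \<sigma> x) \<le> s"
  shows "model_radius V \<mu> a \<sigma>' \<le> model_radius V \<mu> a \<sigma> + s"
proof -
  let ?E = "{\<epsilon>. \<epsilon> > 0 \<and> (1 \<le> \<epsilon> \<or> exp (a * real (card V)) \<le> real (card (good_models V \<sigma> \<mu> \<epsilon>)))}"
  have "model_radius V \<mu> a \<sigma>' - s \<le> Inf ?E"
  proof (rule cInf_greatest)
    show "?E \<noteq> {}" by (auto intro: exI[of _ 1])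
    fix \<epsilon> assume \<epsilon>: "\<epsilon> \<in> ?E"
    have "card (good_models V \<sigma> \<mu> \<epsilon>) \<le> card (good_models V \<sigma>' \<mu> (\<epsilon> + s))"
      by (rule card_mono[OF finite_good_models[OF V(1)]],
          rule good_models_subset[OF V \<mu> \<mu> \<sigma> transport_dist_refl]) simp
    then have "real (card (good_models V \<sigma> \<mu> \<epsilon>)) \<le> real (card (good_models V \<sigma>' \<mu> (\<epsilon> + s)))" by simp
    then have "model_radius V \<mu> a \<sigma>' \<le> \<epsilon> + s"
      using \<epsilon> s by (intro model_radius_le) auto
    then show "model_radius V \<mu> a \<sigma>' - s \<le> \<epsilon>" by simp
  qed
  then show ?thesis by (simp add: model_radius_def)
qed

lemma model_radius_lipschitz:
  obtains c :: real where "c > 0"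
    "\<And>(V :: 'v set) (\<mu> :: ('s::finite free_group \<Rightarrow> 'a::{finite, discrete_topology}) measure) a \<sigma> \<sigma>'.
      finite V \<Longrightarrow> V \<noteq> {} \<Longrightarrow> \<mu> \<in> borel_probs \<Longrightarrow> \<sigma> \<in> Homs V \<Longrightarrow> \<sigma>' \<in> Homs V \<Longrightarrow>
      \<bar>model_radius V \<mu> a \<sigma> / c - model_radius V \<mu> a \<sigma>' / c\<bar> \<le> hom_dist V \<sigma> \<sigma>'"
proof -
  obtain c :: real where c: "c > 0" and
    move: "\<And>(V :: 'v set) (\<sigma> :: 's free_group \<Rightarrow> 'v \<Rightarrow> 'v) \<sigma>' (x :: 'v \<Rightarrow> 'a).
      finite V \<Longrightarrow> differ_by_switching V \<sigma> \<sigma>' \<Longrightarrow>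
      transport_dist (empirical V \<sigma> x) (empirical V \<sigma>' x) \<le> c / real (card V)"
    by (rule switching_moves_empirical) blast
  show thesis
  proof (rule that[OF c])
    fix V :: "'v set" and \<mu> :: "('s free_group \<Rightarrow> 'a) measure" and a :: real
      and \<sigma> \<sigma>' :: "'s free_group \<Rightarrow> 'v \<Rightarrow> 'v"
    assume V: "finite V" "V \<noteq> {}" and \<mu>: "\<mu> \<in> borel_probs" and \<sigma>: "\<sigma> \<in> Homs V" "\<sigma>' \<in> Homs V"
    show "\<bar>model_radius V \<mu> a \<sigma> / c - model_radius V \<mu> a \<sigma>' / c\<bar> \<le> hom_dist V \<sigma> \<sigma>'"
    proof (rule hom_lipschitzI[OF V(1) \<sigma>])
      fix \<tau> \<tau>' :: "'s free_group \<Rightarrow> 'v \<Rightarrow> 'v"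
      assume sw: "differ_by_switching V \<tau> \<tau>'"
      have "model_radius V \<mu> a \<tau> \<le> model_radius V \<mu> a \<tau>' + c / real (card V)"
        using move[OF V(1) sw] c by (intro model_radius_change_hom[OF V \<mu>]) auto
      moreover have "model_radius V \<mu> a \<tau>' \<le> model_radius V \<mu> a \<tau> + c / real (card V)"
        using move[OF V(1) sw] c
        by (intro model_radius_change_hom[OF V \<mu>]) (auto simp: transport_dist_commute[of "empirical V \<tau>' _"])
      ultimately have "\<bar>model_radius V \<mu> a \<tau> - model_radius V \<mu> a \<tau>'\<bar> \<le> c / real (card V)" by linarith
      then have "\<bar>model_radius V \<mu> a \<tau> - model_radius V \<mu> a \<tau>'\<bar> / c \<le> (c / real (card V)) / c"
        using c by (intro divide_right_mono) auto
      then show "\<bar>model_radius V \<mu> a \<tau> / c - model_radius V \<mu> a \<tau>' / c\<bar> \<le> 1 / real (card V)"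
        using c by (simp add: diff_divide_distrib[symmetric])
    qed
  qed
qed

text \<open>
  A countable set of target measures that suffices for all measures: if no empirical measure comes
  close to \<open>\<mu>\<close>, then \<open>\<mu>\<close> has no models at small radius and its entropies are \<open>-\<infinity>\<close>; otherwise \<open>\<mu>\<close> can
  be replaced by a nearby element of this set.
\<close>

definition empirical_measures ::
  "(nat \<Rightarrow> 'v set) \<Rightarrow> ('s::finite free_group \<Rightarrow> 'a::{finite, discrete_topology}) measure set" where
  "empirical_measures V = (\<Union>n. \<Union>\<sigma>\<in>Homs (V n). (\<lambda>x. empirical (V n) \<sigma> x) ` (V n \<rightarrow>\<^sub>E UNIV))"

lemma countable_empirical_measures:
  assumes "\<And>n. finite (V n)" shows "countable (empirical_measures V)"
  unfolding empirical_measures_def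
  by (intro countable_UN countableI_type countable_image countable_finite[OF finite_Homs]
      countable_finite[OF finite_PiE] assms) auto

text \<open>
  If \<open>\<tau>\<close> has a model for \<open>\<mu>\<close> at all, its empirical measure \<open>\<nu>\<close> is close to \<open>\<mu>\<close>.  Then a growth rate above
  \<open>a\<close> along \<open>\<tau>\<close> means a small model radius around \<open>\<nu>\<close>, which is asymptotically the same along \<open>\<tau>'\<close>.
  The statement is pointwise in \<open>n\<close>, so that it serves upper and lower limits alike.
\<close>

lemma model_rate_transfer:
  fixes \<tau> \<tau>' :: "nat \<Rightarrow> 's::finite free_group \<Rightarrow> 'v \<Rightarrow> 'v"
    and \<mu> :: "('s free_group \<Rightarrow> 'a::{finite, discrete_topology}) measure"
  assumes V: "\<And>n. finite (V n)" "\<And>n. V n \<noteq> {}" and \<tau>: "\<And>n. \<tau> n \<in> Homs (V n)"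
    and \<mu>: "\<mu> \<in> borel_probs" and \<epsilon>: "\<epsilon> > 0"
    and close: "\<And>(\<nu> :: ('s free_group \<Rightarrow> 'a) measure) t. \<nu> \<in> empirical_measures V \<Longrightarrow> t > 0 \<Longrightarrow>
      \<forall>\<^sub>F n in sequentially. \<bar>model_radius (V n) \<nu> a (\<tau> n) - model_radius (V n) \<nu> a (\<tau>' n)\<bar> < t"
  shows "\<exists>\<delta>>0. \<forall>\<^sub>F n in sequentially.
    ereal a < model_rate (V n) (\<tau> n) \<mu> \<delta> \<longrightarrow> ereal a \<le> model_rate (V n) (\<tau>' n) \<mu> \<epsilon>"
proof -
  \<comment> \<open>The radius grows from \<open>\<delta>\<close> (around \<open>\<mu>\<close>, along \<open>\<tau>\<close>) over \<open>2\<delta>\<close> and \<open>3\<delta>\<close> (around \<open>\<nu>\<close>) to \<open>4\<delta>\<close> (around \<open>\<mu>\<close>, along \<open>\<tau>'\<close>), and \<open>3\<delta>\<close> must stay below the cap 1.\<close>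
  define \<delta> where "\<delta> = min \<epsilon> 1 / 4"
  have \<delta>: "\<delta> > 0" "4 * \<delta> \<le> \<epsilon>" "3 * \<delta> \<le> 1" using \<epsilon> by (auto simp: \<delta>_def)
  have N: "real (card (V n)) > 0" for n using V by (simp add: card_gt_0_iff)
  show ?thesis
  proof (cases "\<exists>n. good_models (V n) (\<tau> n) \<mu> \<delta> \<noteq> {}")
    case False
    then have "\<not> ereal a < model_rate (V n) (\<tau> n) \<mu> \<delta>" for n
      using N[of n] by (auto simp: elog_def)
    with \<delta>(1) show ?thesis by auto
  next
    case True
    then obtain m x where x: "x \<in> good_models (V m) (\<tau> m) \<mu> \<delta>" by blast
    define \<nu> where "\<nu> = empirical (V m) (\<tau> m) x"
    have \<nu>E: "\<nu> \<in> empirical_measures V"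
      using x \<tau>[of m] by (auto simp: empirical_measures_def \<nu>_def good_models_def)
    have \<nu>: "\<nu> \<in> borel_probs" unfolding \<nu>_def by (rule empirical_borel_probs[OF V])
    have d: "transport_dist \<nu> \<mu> \<le> \<delta>" "transport_dist \<mu> \<nu> \<le> \<delta>"
      using x by (auto simp: good_models_def \<nu>_def transport_dist_commute[of \<mu>])
    have "\<forall>\<^sub>F n in sequentially. ereal a < model_rate (V n) (\<tau> n) \<mu> \<delta> \<longrightarrow> ereal a \<le> model_rate (V n) (\<tau>' n) \<mu> \<epsilon>"
      using close[OF \<nu>E \<delta>(1)]
    proof (rule eventually_mono, intro impI)
      fix n
      assume near: "\<bar>model_radius (V n) \<nu> a (\<tau> n) - model_radius (V n) \<nu> a (\<tau>' n)\<bar> < \<delta>"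
        and "ereal a < model_rate (V n) (\<tau> n) \<mu> \<delta>"
      then have "exp (a * real (card (V n))) \<le> real (card (good_models (V n) (\<tau> n) \<mu> \<delta>))"
        by (intro exp_le_if_rate_greater[OF N]) auto
      also have "\<dots> \<le> real (card (good_models (V n) (\<tau> n) \<nu> (2 * \<delta>)))"
        using card_good_models_change_measure[OF V \<mu> \<nu> d(2), of \<delta> "2 * \<delta>" n] by simp
      finally have "model_radius (V n) \<nu> a (\<tau> n) \<le> 2 * \<delta>"
        using \<delta>(1) by (intro model_radius_le) auto
      then have "model_radius (V n) \<nu> a (\<tau>' n) < 3 * \<delta>" using near by linarith
      then have "exp (a * real (card (V n))) \<le> real (card (good_models (V n) (\<tau>' n) \<nu> (3 * \<delta>)))"
        by (intro model_radius_less[OF V \<nu>]) (use \<delta> in auto)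
      also have "\<dots> \<le> real (card (good_models (V n) (\<tau>' n) \<mu> \<epsilon>))"
        using card_good_models_change_measure[OF V \<nu> \<mu> d(1), of "3 * \<delta>" \<epsilon> n] \<delta>(2) by simp
      finally show "ereal a \<le> model_rate (V n) (\<tau>' n) \<mu> \<epsilon>"
        by (rule rate_ge_if_exp_le[OF N])
    qed
    with \<delta>(1) show ?thesis by blast
  qed
qed

lemma ereal_le_if_rats_le:
  fixes x y :: ereal
  assumes "\<And>a. a \<in> \<rat> \<Longrightarrow> ereal a < x \<Longrightarrow> ereal a \<le> y"
  shows "x \<le> y"
proof (rule ccontr)
  assume "\<not> x \<le> y"
  then obtain q where "y < real_of_rat q" "real_of_rat q < x"
    using ereal_dense3[of y x] by (auto simp: not_le)
  with assms[of "real_of_rat q"] show False by auto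
qed

text \<open>
  Rational growth rates suffice because they are dense, which keeps the family of radii countable.
\<close>

lemma entropies_le:
  fixes \<tau> \<tau>' :: "nat \<Rightarrow> 's::finite free_group \<Rightarrow> 'v \<Rightarrow> 'v"
    and \<mu> :: "('s free_group \<Rightarrow> 'a::{finite, discrete_topology}) measure"
  assumes V: "\<And>n. finite (V n)" "\<And>n. V n \<noteq> {}" and \<tau>: "\<And>n. \<tau> n \<in> Homs (V n)"
    and \<mu>: "\<mu> \<in> borel_probs"
    and close: "\<And>(\<nu> :: ('s free_group \<Rightarrow> 'a) measure) a t. \<nu> \<in> empirical_measures V \<Longrightarrow> a \<in> \<rat> \<Longrightarrow> t > 0 \<Longrightarrow>
      \<forall>\<^sub>F n in sequentially. \<bar>model_radius (V n) \<nu> a (\<tau> n) - model_radius (V n) \<nu> a (\<tau>' n)\<bar> < t"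
  shows "upper_entropy V \<tau> \<mu> \<le> upper_entropy V \<tau>' \<mu>" and "lower_entropy V \<tau> \<mu> \<le> lower_entropy V \<tau>' \<mu>"
proof -
  have transfer: "\<exists>\<delta>>0. \<forall>\<^sub>F n in sequentially.
      ereal a < model_rate (V n) (\<tau> n) \<mu> \<delta> \<longrightarrow> ereal a \<le> model_rate (V n) (\<tau>' n) \<mu> \<epsilon>"
    if "a \<in> \<rat>" "\<epsilon> > 0" for a \<epsilon>
    by (rule model_rate_transfer[OF V \<tau> \<mu> that(2) close[OF _ that(1)]])
  show "upper_entropy V \<tau> \<mu> \<le> upper_entropy V \<tau>' \<mu>"
  proof (rule ereal_le_if_rats_le)
    fix a assume a: "a \<in> \<rat>" "ereal a < upper_entropy V \<tau> \<mu>"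
    show "ereal a \<le> upper_entropy V \<tau>' \<mu>"
      unfolding upper_entropy_def
    proof (rule INF_greatest)
      fix \<epsilon> :: real assume "\<epsilon> \<in> {0<..}"
      then obtain \<delta> where \<delta>: "\<delta> > 0" and ev: "\<forall>\<^sub>F n in sequentially.
          ereal a < model_rate (V n) (\<tau> n) \<mu> \<delta> \<longrightarrow> ereal a \<le> model_rate (V n) (\<tau>' n) \<mu> \<epsilon>"
        using transfer[OF a(1)] by auto
      have "ereal a < limsup (\<lambda>n. model_rate (V n) (\<tau> n) \<mu> \<delta>)"
        using a(2) \<delta> unfolding upper_entropy_def by (meson INF_lower greaterThan_iff less_le_trans)
      from frequently_mp[OF ev less_limsup_frequently[OF this]]
      show "ereal a \<le> limsup (\<lambda>n. model_rate (V n) (\<tau>' n) \<mu> \<epsilon>)" by (rule frequently_le_Limsup)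
    qed
  qed
  show "lower_entropy V \<tau> \<mu> \<le> lower_entropy V \<tau>' \<mu>"
  proof (rule ereal_le_if_rats_le)
    fix a assume a: "a \<in> \<rat>" "ereal a < lower_entropy V \<tau> \<mu>"
    show "ereal a \<le> lower_entropy V \<tau>' \<mu>"
      unfolding lower_entropy_def
    proof (rule INF_greatest)
      fix \<epsilon> :: real assume "\<epsilon> \<in> {0<..}"
      then obtain \<delta> where \<delta>: "\<delta> > 0" and ev: "\<forall>\<^sub>F n in sequentially.
          ereal a < model_rate (V n) (\<tau> n) \<mu> \<delta> \<longrightarrow> ereal a \<le> model_rate (V n) (\<tau>' n) \<mu> \<epsilon>"
        using transfer[OF a(1)] by auto
      have "ereal a < liminf (\<lambda>n. model_rate (V n) (\<tau> n) \<mu> \<delta>)"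
        using a(2) \<delta> unfolding lower_entropy_def by (meson INF_lower greaterThan_iff less_le_trans)
      from eventually_mp[OF ev less_LiminfD[OF this]]
      show "ereal a \<le> liminf (\<lambda>n. model_rate (V n) (\<tau>' n) \<mu> \<epsilon>)" by (rule Liminf_bounded)
    qed
  qed
qed

lemma entropies_upper_semicontinuous:
  fixes \<tau> :: "nat \<Rightarrow> 's::finite free_group \<Rightarrow> 'v \<Rightarrow> 'v"
  assumes V: "\<And>n. finite (V n)" "\<And>n. V n \<noteq> {}"
  shows "upper_semicontinuous_map weak_topology
      (upper_entropy V \<tau> :: ('s free_group \<Rightarrow> 'a::{finite, discrete_topology}) measure \<Rightarrow> ereal)"
    and "upper_semicontinuous_map weak_topology
      (lower_entropy V \<tau> :: ('s free_group \<Rightarrow> 'a::{finite, discrete_topology}) measure \<Rightarrow> ereal)"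
proof -
  have mono: "model_rate (V n) (\<tau> n) \<nu> \<epsilon> \<le> model_rate (V n) (\<tau> n) \<mu> (2 * \<epsilon>)"
    if "\<mu> \<in> Prob_inv" "\<nu> \<in> Prob_inv" "transport_dist \<nu> \<mu> < \<epsilon>"
    for \<mu> \<nu> :: "('s free_group \<Rightarrow> 'a) measure" and \<epsilon> n
    by (rule model_rate_change_measure[OF V Prob_inv_borel Prob_inv_borel, of \<nu> \<mu> \<epsilon>]) (use that in auto)
  show "upper_semicontinuous_map weak_topology
      (upper_entropy V \<tau> :: ('s free_group \<Rightarrow> 'a) measure \<Rightarrow> ereal)"
    unfolding upper_entropy_def[abs_def]
    by (rule upper_semicontinuous_INF_scales) (auto intro!: Limsup_mono always_eventually mono)
  show "upper_semicontinuous_map weak_topology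
      (lower_entropy V \<tau> :: ('s free_group \<Rightarrow> 'a) measure \<Rightarrow> ereal)"
    unfolding lower_entropy_def[abs_def]
    by (rule upper_semicontinuous_INF_scales) (auto intro!: Liminf_mono always_eventually mono)
qed

lemma entropies_in_range:
  fixes \<tau> :: "nat \<Rightarrow> 's::finite free_group \<Rightarrow> 'v \<Rightarrow> 'v"
    and \<mu> :: "('s free_group \<Rightarrow> 'a::{finite, discrete_topology}) measure"
  assumes V: "\<And>n. finite (V n)" "\<And>n. V n \<noteq> {}"
  shows "upper_entropy V \<tau> \<mu> \<in> entropy_range (ln (real CARD('a)))"
    and "lower_entropy V \<tau> \<mu> \<in> entropy_range (ln (real CARD('a)))"
  unfolding upper_entropy_def lower_entropy_def
  by (intro INF_scales_in_range limsup_in_range liminf_in_range model_rate_range V)+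

section \<open>Diagonal choice of typical sets\<close>

lemma random_event_sets:
  assumes "X \<in> M \<rightarrow>\<^sub>M count_space H"
  shows "{\<omega> \<in> space M. X \<omega> \<in> A} \<in> sets M"
proof -
  have "X -` (A \<inter> H) \<inter> space M \<in> sets M" using assms by (rule measurable_sets) simp
  moreover have "X -` (A \<inter> H) \<inter> space M = {\<omega> \<in> space M. X \<omega> \<in> A}"
    using measurable_space[OF assms] by auto
  ultimately show ?thesis by simp
qed

text \<open>
  Enumerate the countably many families of exceptional sets.  At time \<open>n\<close> discard only the first
  \<open>K n\<close> of them, where \<open>K\<close> tends to infinity so slowly that the discarded part still has
  probability below \<open>1 / (K n + 1)\<close>.  The strict bound also keeps every \<open>S n\<close> nonempty.
\<close>

lemma diagonal_good_sets:
  fixes M :: "nat \<Rightarrow> 'w measure" and X :: "nat \<Rightarrow> 'w \<Rightarrow> 'h" and H :: "nat \<Rightarrow> 'h set"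
  assumes M: "\<And>n. prob_space (M n)" and X: "\<And>n. X n \<in> M n \<rightarrow>\<^sub>M count_space (H n)"
    and countable: "countable \<B>"
    and small: "\<And>B. B \<in> \<B> \<Longrightarrow> (\<lambda>n. measure (M n) {\<omega> \<in> space (M n). X n \<omega> \<in> B n}) \<longlonglongrightarrow> 0"
  shows "\<exists>S. (\<forall>n. S n \<subseteq> H n \<and> S n \<noteq> {}) \<and>
    (\<lambda>n. measure (M n) {\<omega> \<in> space (M n). X n \<omega> \<in> S n}) \<longlonglongrightarrow> 1 \<and>
    (\<forall>B\<in>\<B>. \<forall>\<^sub>F n in sequentially. S n \<inter> B n = {})"
proof -
  \<comment> \<open>The empty exceptional family is added so that there is something to enumerate.\<close>
  define \<B>' where "\<B>' = insert (\<lambda>n. {}) \<B>"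
  define b where "b j = from_nat_into \<B>' j" for j
  have bB: "b j \<in> \<B>'" for j unfolding b_def by (rule from_nat_into) (simp add: \<B>'_def)
  define p where "p n A = measure (M n) {\<omega> \<in> space (M n). X n \<omega> \<in> A}" for n A
  have small': "(\<lambda>n. p n (b j n)) \<longlonglongrightarrow> 0" for j
    using bB[of j] small by (auto simp: \<B>'_def p_def)
  define U where "U k n = (\<Union>j<k. b j n)" for k n
  have pU: "(\<lambda>n. p n (U k n)) \<longlonglongrightarrow> 0" for k
  proof (rule tendsto_sandwich[OF _ _ tendsto_const])
    show "\<forall>\<^sub>F n in sequentially. 0 \<le> p n (U k n)" by (simp add: p_def)
    show "(\<lambda>n. \<Sum>j<k. p n (b j n)) \<longlonglongrightarrow> 0"
      using tendsto_sum[of "{..<k}" "\<lambda>j n. p n (b j n)" "\<lambda>_. 0" sequentially] small' by simp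
    show "\<forall>\<^sub>F n in sequentially. p n (U k n) \<le> (\<Sum>j<k. p n (b j n))"
    proof (rule always_eventually, rule allI)
      fix n
      interpret prob_space "M n" by (rule M)
      have "p n (U k n) = measure (M n) (\<Union>j<k. {\<omega> \<in> space (M n). X n \<omega> \<in> b j n})"
        unfolding p_def U_def by (rule arg_cong[where f="measure (M n)"]) auto
      also have "\<dots> \<le> (\<Sum>j<k. p n (b j n))"
        unfolding p_def by (rule finite_measure_subadditive_finite) (auto intro: random_event_sets[OF X])
      finally show "p n (U k n) \<le> (\<Sum>j<k. p n (b j n))" .
    qed
  qed
  \<comment> \<open>The condition covers all later times and \<open>good 0 n\<close> always holds, so \<open>K\<close> is well defined and eventually exceeds every \<open>J\<close>.\<close>
  define good where "good k n \<longleftrightarrow> (\<forall>m\<ge>n. p m (U k m) < 1 / real (Suc k))" for k n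
  define K where "K n = Max {k. k \<le> n \<and> good k n}" for n
  have "good 0 n" for n by (simp add: good_def U_def p_def)
  then have K_in: "K n \<in> {k. k \<le> n \<and> good k n}" for n
    unfolding K_def by (intro Max_in) auto
  have K_large: "\<forall>\<^sub>F n in sequentially. J \<le> K n" for J
  proof -
    have "\<forall>\<^sub>F n in sequentially. p n (U J n) < 1 / real (Suc J)"
      using pU[of J] by (rule order_tendstoD) simp
    then obtain n0 where n0: "\<And>n. n \<ge> n0 \<Longrightarrow> p n (U J n) < 1 / real (Suc J)"
      by (auto simp: eventually_sequentially)
    have "J \<le> K n" if "n \<ge> max n0 J" for n
      unfolding K_def by (rule Max_ge) (use that n0 in \<open>auto simp: good_def\<close>)
    then show ?thesis unfolding eventually_sequentially by blast
  qed
  define S where "S n = H n - U (K n) n" for n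
  have pS: "p n (S n) > 1 - 1 / real (Suc (K n))" "p n (S n) \<le> 1" for n
  proof -
    interpret prob_space "M n" by (rule M)
    have "p n (S n) = measure (M n) (space (M n) - {\<omega> \<in> space (M n). X n \<omega> \<in> U (K n) n})"
      unfolding p_def S_def using measurable_space[OF X[of n]]
      by (intro arg_cong[where f="measure (M n)"]) auto
    also have "\<dots> = 1 - p n (U (K n) n)"
      unfolding p_def by (rule prob_compl) (rule random_event_sets[OF X])
    finally have "p n (S n) = 1 - p n (U (K n) n)" .
    moreover have "p n (U (K n) n) < 1 / real (Suc (K n))"
      using K_in[of n] by (simp add: good_def)
    ultimately show "p n (S n) > 1 - 1 / real (Suc (K n))" "p n (S n) \<le> 1"
      by (auto simp: p_def)
  qed
  show ?thesis
  proof (intro exI[of _ S] conjI allI ballI)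
    show "S n \<subseteq> H n" for n by (auto simp: S_def)
    show "S n \<noteq> {}" for n
    proof
      assume "S n = {}"
      then have "p n (S n) = 0" by (simp add: p_def)
      then show False using pS(1)[of n] by (simp add: field_simps)
    qed
    have "(\<lambda>n. p n (S n)) \<longlonglongrightarrow> 1"
    proof (rule order_tendstoI)
      fix a :: real assume "a < 1"
      then obtain J where J: "1 / real (Suc J) < 1 - a" using nat_approx_posE[of "1 - a"] by auto
      show "\<forall>\<^sub>F n in sequentially. a < p n (S n)"
        using K_large[of J]
      proof (rule eventually_mono)
        fix n assume "J \<le> K n"
        then have "1 / real (Suc (K n)) \<le> 1 / real (Suc J)" by (intro divide_left_mono) auto
        then show "a < p n (S n)" using pS(1)[of n] J by linarith
      qed
    next
      fix a :: real assume "1 < a"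
      then show "\<forall>\<^sub>F n in sequentially. p n (S n) < a"
        using pS(2) by (intro always_eventually allI) (meson le_less_trans)
    qed
    then show "(\<lambda>n. measure (M n) {\<omega> \<in> space (M n). X n \<omega> \<in> S n}) \<longlonglongrightarrow> 1"
      by (simp add: p_def)
    fix B assume "B \<in> \<B>"
    then obtain j where j: "b j = B"
      using from_nat_into_surj[of \<B>' B] countable by (auto simp: b_def \<B>'_def)
    show "\<forall>\<^sub>F n in sequentially. S n \<inter> B n = {}"
      using K_large[of "Suc j"] by (rule eventually_mono) (use j in \<open>auto simp: S_def U_def\<close>)
  qed
qed

section \<open>Non-sofic homomorphisms and the growth of the vertex sets\<close>

lemma non_sofic_probability_tendsto_0:
  assumes \<sigma>: "random_sofic_approximation V M \<sigma>" and F: "finite F" "\<delta> > 0"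
  shows "(\<lambda>n. measure (M n) {\<omega> \<in> space (M n). \<not> sofic_hom (V n) (\<sigma> n \<omega>) F \<delta>}) \<longlonglongrightarrow> 0"
    (is "?p \<longlonglongrightarrow> 0")
proof (rule order_tendstoI)
  fix e :: real assume "e < 0"
  then show "\<forall>\<^sub>F n in sequentially. e < ?p n"
    by (intro always_eventually allI) (meson less_le_trans measure_nonneg)
next
  fix e :: real assume e: "0 < e"
  define C where "C = max 0 (- ln e)"
  have "limsup (\<lambda>n. elog (?p n) / ereal (real (card (V n)))) = -\<infinity>"
    using \<sigma> F by (auto simp: random_sofic_approximation_def)
  then have "\<forall>\<^sub>F n in sequentially. elog (?p n) / ereal (real (card (V n))) < ereal (- C)"
    by (intro Limsup_lessD) simp
  then show "\<forall>\<^sub>F n in sequentially. ?p n < e"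
  proof (rule eventually_mono)
    fix n assume less: "elog (?p n) / ereal (real (card (V n))) < ereal (- C)"
    have "finite (V n)" "V n \<noteq> {}"
      using \<sigma> by (auto simp: random_sofic_approximation_def random_homs_def)
    then have N: "real (card (V n)) \<ge> 1" by (simp add: Suc_le_eq card_gt_0_iff)
    show "?p n < e"
    proof (cases "?p n = 0")
      case True
      then show ?thesis using e by simp
    next
      case False
      then have "ln (?p n) / real (card (V n)) < - C" using less N by (simp add: elog_def)
      then have "ln (?p n) < - C * real (card (V n))" using N by (simp add: field_simps)
      also have "\<dots> \<le> - C" using N mult_left_mono[OF N, of C] by (simp add: C_def)
      also have "\<dots> \<le> ln e" by (simp add: C_def)
      finally show ?thesis using False e measure_nonneg[of "M n"] by (metis ln_less_cancel_iff order_le_less)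
    qed
  qed
qed

text \<open>
  The image of a word in the integers when all generators are sent to 1; it distinguishes the powers
  of a generator.
\<close>

definition exponent_sum :: "('s \<times> bool) list \<Rightarrow> int" where
  "exponent_sum w = sum_list (map (\<lambda>(k, b). if b then 1 else -1) w)"

lemma infinite_free_group: "infinite (UNIV :: 's free_group set)"
proof -
  have cong: "exponent_sum u = exponent_sum w" if "word_eq u w" for u w :: "('s \<times> bool) list"
    using that
  proof (induction rule: equivclp_induct)
    case (step y z)
    have "exponent_sum y = exponent_sum z" if "cancel_step y z" for y z :: "('s \<times> bool) list"
      using that by cases (auto simp: exponent_sum_def)
    with step show ?case by metis
  qed simp
  have "inj (\<lambda>n. abs_free_group (replicate n (undefined :: 's, True)))"
  proof (rule injI)
    fix m n
    assume "abs_free_group (replicate m (undefined :: 's, True)) = abs_free_group (replicate n (undefined, True))"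
    then have "exponent_sum (replicate m (undefined :: 's, True)) = exponent_sum (replicate n (undefined :: 's, True))"
      by (intro cong) (simp add: free_group.abs_eq_iff)
    then show "m = n" by (simp add: exponent_sum_def sum_list_replicate)
  qed
  then show ?thesis by (rule range_inj_infinite[THEN infinite_super[rotated]]) simp
qed

text \<open>
  If a homomorphism is \<open>(F, 1)\<close>-sofic, then some point has \<open>card F\<close> distinct translates under \<open>F\<close>.
  As the free group is infinite, \<open>F\<close> can be arbitrarily large.  Growth of \<open>V n\<close> is what turns the
  concentration bound into a probability tending to zero.
\<close>

lemma card_tendsto_infinity:
  fixes \<sigma> :: "nat \<Rightarrow> 'w \<Rightarrow> 's free_group \<Rightarrow> 'v \<Rightarrow> 'v"
  assumes \<sigma>: "random_sofic_approximation V M \<sigma>"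
  shows "filterlim (\<lambda>n. real (card (V n))) at_top sequentially"
proof -
  have "\<forall>\<^sub>F n in sequentially. m \<le> card (V n)" for m
  proof -
    obtain F :: "'s free_group set" where F: "finite F" "card F = m"
      using infinite_arbitrarily_large[OF infinite_free_group] by blast
    have "\<forall>\<^sub>F n in sequentially. measure (M n) {\<omega> \<in> space (M n). \<not> sofic_hom (V n) (\<sigma> n \<omega>) F 1} < 1"
      using non_sofic_probability_tendsto_0[OF \<sigma> F(1), of 1] by (rule order_tendstoD) auto
    then show ?thesis
    proof (rule eventually_mono)
      fix n
      assume less: "measure (M n) {\<omega> \<in> space (M n). \<not> sofic_hom (V n) (\<sigma> n \<omega>) F 1} < 1"
      have h: "finite (V n)" "prob_space (M n)" "\<sigma> n \<in> M n \<rightarrow>\<^sub>M count_space (Homs (V n))"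
        using \<sigma> by (auto simp: random_sofic_approximation_def random_homs_def)
      interpret prob_space "M n" by (rule h(2))
      have "{\<omega> \<in> space (M n). \<not> sofic_hom (V n) (\<sigma> n \<omega>) F 1} \<noteq> space (M n)"
        using less prob_space by auto
      then obtain \<omega> where \<omega>: "\<omega> \<in> space (M n)" "sofic_hom (V n) (\<sigma> n \<omega>) F 1" by blast
      have hom: "\<sigma> n \<omega> \<in> Homs (V n)" using measurable_space[OF h(3) \<omega>(1)] by simp
      have "{v \<in> V n. \<forall>\<gamma>\<^sub>1\<in>F. \<forall>\<gamma>\<^sub>2\<in>F. \<gamma>\<^sub>1 \<noteq> \<gamma>\<^sub>2 \<longrightarrow> \<sigma> n \<omega> \<gamma>\<^sub>1 v \<noteq> \<sigma> n \<omega> \<gamma>\<^sub>2 v} \<noteq> {}"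
        using \<omega>(2) unfolding sofic_hom_def by (metis (no_types, lifting) card.empty diff_self div_0 less_irrefl of_nat_0)
      then obtain v where v: "v \<in> V n" "inj_on (\<lambda>\<gamma>. \<sigma> n \<omega> \<gamma> v) F" by (auto simp: inj_on_def)
      have "card F \<le> card (V n)"
        by (rule card_inj_on_le[OF v(2) _ h(1)]) (use hom_in[OF hom v(1)] in auto)
      then show "m \<le> card (V n)" using F(2) by simp
    qed
  qed
  then have "filterlim (\<lambda>n. card (V n)) at_top sequentially" by (simp add: filterlim_at_top)
  then show ?thesis by (rule filterlim_compose[OF filterlim_real_sequentially])
qed

section \<open>Entropy along typical sequences is deterministic\<close>

theorem theorem1p1:
  fixes V :: "nat \<Rightarrow> 'v set"
    and M :: "nat \<Rightarrow> 'w measure"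
    and \<sigma> :: "nat \<Rightarrow> 'w \<Rightarrow> 's::finite free_group \<Rightarrow> 'v \<Rightarrow> 'v"
  assumes "random_sofic_approximation V M \<sigma>"
    and "exponentially_concentrated V M \<sigma>"
  shows "\<exists>h_sharp h_flat ::
           ('s free_group \<Rightarrow> 'a::{finite, discrete_topology}) measure \<Rightarrow> ereal.
           upper_semicontinuous_map weak_topology h_sharp \<and>
           upper_semicontinuous_map weak_topology h_flat \<and>
           h_sharp \<in> Prob_inv \<rightarrow> {-\<infinity>} \<union> {0..ereal (ln (real CARD('a)))} \<and>
           h_flat \<in> Prob_inv \<rightarrow> {-\<infinity>} \<union> {0..ereal (ln (real CARD('a)))} \<and>
           (\<exists>S. (\<forall>n. S n \<subseteq> Homs (V n) \<and> S n \<noteq> {}) \<and>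
                (\<lambda>n. measure (M n) {\<omega> \<in> space (M n). \<sigma> n \<omega> \<in> S n}) \<longlonglongrightarrow> 1 \<and>
                (\<forall>\<tau>. (\<forall>n. \<tau> n \<in> S n) \<longrightarrow>
                   sofic_approximation V \<tau> \<and>
                   (\<forall>\<mu>\<in>Prob_inv.
                      upper_entropy V \<tau> \<mu> = h_sharp \<mu> \<and> lower_entropy V \<tau> \<mu> = h_flat \<mu>)))"
proof -
  have V: "\<And>n. finite (V n)" "\<And>n. V n \<noteq> {}" and M: "\<And>n. prob_space (M n)"
    and \<sigma>: "\<And>n. \<sigma> n \<in> M n \<rightarrow>\<^sub>M count_space (Homs (V n))"
    using assms(1) by (auto simp: random_sofic_approximation_def random_homs_def)
  obtain C where C: "C > 0" and conc: "\<And>n (f :: ('s free_group \<Rightarrow> 'v \<Rightarrow> 'v) \<Rightarrow> real) t.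
      (\<And>\<sigma>\<^sub>1 \<sigma>\<^sub>2. \<sigma>\<^sub>1 \<in> Homs (V n) \<Longrightarrow> \<sigma>\<^sub>2 \<in> Homs (V n) \<Longrightarrow> \<bar>f \<sigma>\<^sub>1 - f \<sigma>\<^sub>2\<bar> \<le> hom_dist (V n) \<sigma>\<^sub>1 \<sigma>\<^sub>2) \<Longrightarrow> t > 0 \<Longrightarrow>
      measure (M n) {\<omega> \<in> space (M n). \<bar>f (\<sigma> n \<omega>) - (\<integral>\<omega>'. f (\<sigma> n \<omega>') \<partial>M n)\<bar> > t}
        \<le> 2 * exp (- C * real (card (V n)) * t ^ 2)"
    using assms(2) unfolding exponentially_concentrated_def by blast
  obtain c :: real where c: "c > 0" and
    lip: "\<And>(W :: 'v set) (\<nu> :: ('s free_group \<Rightarrow> 'a) measure) a \<sigma>\<^sub>1 \<sigma>\<^sub>2.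
      finite W \<Longrightarrow> W \<noteq> {} \<Longrightarrow> \<nu> \<in> borel_probs \<Longrightarrow> \<sigma>\<^sub>1 \<in> Homs W \<Longrightarrow> \<sigma>\<^sub>2 \<in> Homs W \<Longrightarrow>
      \<bar>model_radius W \<nu> a \<sigma>\<^sub>1 / c - model_radius W \<nu> a \<sigma>\<^sub>2 / c\<bar> \<le> hom_dist W \<sigma>\<^sub>1 \<sigma>\<^sub>2"
    by (rule model_radius_lipschitz) blast
  define E :: "('s free_group \<Rightarrow> 'a) measure set" where "E = empirical_measures V"
  have E: "\<nu> \<in> borel_probs" if "\<nu> \<in> E" for \<nu>
    using that empirical_borel_probs[OF V] by (auto simp: E_def empirical_measures_def)
  define R where "R n \<nu> a \<tau> = model_radius (V n) \<nu> a \<tau> / c" for n a \<tau> and \<nu> :: "('s free_group \<Rightarrow> 'a) measure"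
  define mean where "mean n \<nu> a = (\<integral>\<omega>. R n \<nu> a (\<sigma> n \<omega>) \<partial>M n)" for n \<nu> a
  \<comment> \<open>Countably many exceptional families: one for each empirical measure, rational growth rate and precision, and one for each soficity requirement.\<close>
  define atypical where "atypical \<nu> a j n = {\<tau>. \<bar>R n \<nu> a \<tau> - mean n \<nu> a\<bar> > 1 / real (Suc j)}" for \<nu> a j n
  define non_sofic where "non_sofic F j n = {\<tau>. \<not> sofic_hom (V n) \<tau> F (1 / real (Suc j))}"
    for F :: "'s free_group set" and j n
  define \<B> where "\<B> = (\<lambda>(\<nu>, a, j). atypical \<nu> a j) ` (E \<times> \<rat> \<times> UNIV)
      \<union> (\<lambda>(F, j). non_sofic F j) ` ({F. finite F \<and> F \<subseteq> UNIV} \<times> UNIV)"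
  have "countable E" unfolding E_def by (rule countable_empirical_measures[OF V(1)])
  then have "countable \<B>"
    unfolding \<B>_def
    by (intro countable_Un countable_image countable_SIGMA countable_rat countableI_type
        countable_Collect_finite_subset countable_free_group)
  moreover have "(\<lambda>n. measure (M n) {\<omega> \<in> space (M n). \<sigma> n \<omega> \<in> B n}) \<longlonglongrightarrow> 0" if "B \<in> \<B>" for B
    using that unfolding \<B>_def
  proof (elim UnE imageE, goal_cases)
    case (1 i)
    then obtain \<nu> a j where i: "B = atypical \<nu> a j" "\<nu> \<in> E" by auto
    let ?t = "1 / real (Suc j)"
    have bound: "measure (M n) {\<omega> \<in> space (M n). \<sigma> n \<omega> \<in> B n} \<le> 2 * exp (- C * real (card (V n)) * ?t ^ 2)" for n
      using conc[of n "R n \<nu> a" ?t] lip[OF V E[OF i(2)]] by (simp add: i(1) atypical_def mean_def R_def)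
    have "filterlim (\<lambda>n. (C * ?t ^ 2) * real (card (V n))) at_top sequentially"
      by (rule filterlim_tendsto_pos_mult_at_top[OF tendsto_const _ card_tendsto_infinity[OF assms(1)]])
        (use C in simp)
    then have "(\<lambda>n. exp (- ((C * ?t ^ 2) * real (card (V n))))) \<longlonglongrightarrow> 0"
      by (intro filterlim_compose[OF exp_at_bot]) (simp add: filterlim_uminus_at_bot)
    then have "(\<lambda>n. 2 * exp (- C * real (card (V n)) * ?t ^ 2)) \<longlonglongrightarrow> 0"
      using tendsto_mult_right_zero[of _ sequentially 2] by (simp add: mult_ac)
    then show ?case
      by (rule tendsto_sandwich[OF _ _ tendsto_const, rotated 2])
        (use bound in \<open>auto intro: always_eventually\<close>)
  next
    case (2 i)
    then show ?case
      using non_sofic_probability_tendsto_0[OF assms(1)] by (auto simp: non_sofic_def)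
  qed
  ultimately have "\<exists>S. (\<forall>n. S n \<subseteq> Homs (V n) \<and> S n \<noteq> {}) \<and>
      (\<lambda>n. measure (M n) {\<omega> \<in> space (M n). \<sigma> n \<omega> \<in> S n}) \<longlonglongrightarrow> 1 \<and>
      (\<forall>B\<in>\<B>. \<forall>\<^sub>F n in sequentially. S n \<inter> B n = {})"
    by (rule diagonal_good_sets[OF M \<sigma>])
  then obtain S where S: "\<And>n. S n \<subseteq> Homs (V n)" "\<And>n. S n \<noteq> {}"
    "(\<lambda>n. measure (M n) {\<omega> \<in> space (M n). \<sigma> n \<omega> \<in> S n}) \<longlonglongrightarrow> 1"
    and avoid: "\<And>B. B \<in> \<B> \<Longrightarrow> \<forall>\<^sub>F n in sequentially. S n \<inter> B n = {}"
    by blast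
  have sofic: "sofic_approximation V \<tau>" if \<tau>: "\<And>n. \<tau> n \<in> S n" for \<tau>
    unfolding sofic_approximation_def
  proof (intro conjI allI impI)
    show "finite (V n)" "V n \<noteq> {}" "\<tau> n \<in> Homs (V n)" for n
      using V subsetD[OF S(1) \<tau>] by auto
    fix F :: "'s free_group set" and \<delta> :: real assume F: "finite F \<and> \<delta> > 0"
    then obtain j where j: "1 / real (Suc j) < \<delta>" using nat_approx_posE by auto
    have "non_sofic F j \<in> \<B>" using F by (auto simp: \<B>_def)
    from avoid[OF this] show "\<forall>\<^sub>F n in sequentially. sofic_hom (V n) (\<tau> n) F \<delta>"
    proof (rule eventually_mono)
      fix n assume "S n \<inter> non_sofic F j n = {}"
      then have "sofic_hom (V n) (\<tau> n) F (1 / real (Suc j))"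
        using \<tau>[of n] by (auto simp: non_sofic_def)
      then show "sofic_hom (V n) (\<tau> n) F \<delta>" using j unfolding sofic_hom_def by linarith
    qed
  qed
  have close: "\<forall>\<^sub>F n in sequentially. \<bar>model_radius (V n) \<nu> a (\<tau> n) - model_radius (V n) \<nu> a (\<tau>' n)\<bar> < t"
    if \<tau>: "\<And>n. \<tau> n \<in> S n" "\<And>n. \<tau>' n \<in> S n" and \<nu>: "\<nu> \<in> E" and a: "a \<in> \<rat>" and t: "t > 0"
    for \<tau> \<tau>' \<nu> a t
  proof -
    have "t / c / 2 > 0" using t c by simp
    then obtain j where j: "1 / real (Suc j) < t / c / 2" by (rule nat_approx_posE)
    have triangle: "\<bar>x - y\<bar> < d" if "\<bar>x - m\<bar> \<le> e" "\<bar>y - m\<bar> \<le> e" "e < d / 2" for x y m e d :: real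
      using that by linarith
    have "atypical \<nu> a j \<in> \<B>" using \<nu> a by (force simp: \<B>_def)
    from avoid[OF this] show ?thesis
    proof (rule eventually_mono)
      fix n assume "S n \<inter> atypical \<nu> a j n = {}"
      then have "\<bar>R n \<nu> a (\<tau> n) - mean n \<nu> a\<bar> \<le> 1 / real (Suc j)" "\<bar>R n \<nu> a (\<tau>' n) - mean n \<nu> a\<bar> \<le> 1 / real (Suc j)"
        using \<tau>(1)[of n] \<tau>(2)[of n] by (auto simp: atypical_def not_less)
      then have "\<bar>R n \<nu> a (\<tau> n) - R n \<nu> a (\<tau>' n)\<bar> < t / c"
        by (rule triangle[OF _ _ j])
      then show "\<bar>model_radius (V n) \<nu> a (\<tau> n) - model_radius (V n) \<nu> a (\<tau>' n)\<bar> < t"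
        using c by (simp add: R_def diff_divide_distrib[symmetric] divide_less_cancel)
    qed
  qed
  \<comment> \<open>All sequences in the sets \<open>S n\<close> have the same entropies, so any one of them may serve to define the two functions.\<close>
  define \<tau>0 where "\<tau>0 n = (SOME \<tau>. \<tau> \<in> S n)" for n
  have \<tau>0: "\<tau>0 n \<in> S n" for n unfolding \<tau>0_def using S(2) by (simp add: some_in_eq)
  have same: "upper_entropy V \<tau> \<mu> = upper_entropy V \<tau>0 \<mu> \<and> lower_entropy V \<tau> \<mu> = lower_entropy V \<tau>0 \<mu>"
    if \<tau>: "\<And>n. \<tau> n \<in> S n" and \<mu>: "\<mu> \<in> Prob_inv" for \<tau> and \<mu> :: "('s free_group \<Rightarrow> 'a) measure"
  proof -
    have H: "\<And>n. \<tau> n \<in> Homs (V n)" "\<And>n. \<tau>0 n \<in> Homs (V n)" using subsetD[OF S(1)] \<tau> \<tau>0 by auto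
    note le = entropies_le[OF V H(1) Prob_inv_borel[OF \<mu>] close[OF \<tau> \<tau>0, unfolded E_def]]
    note ge = entropies_le[OF V H(2) Prob_inv_borel[OF \<mu>] close[OF \<tau>0 \<tau>, unfolded E_def]]
    show ?thesis by (intro conjI antisym le ge)
  qed
  show ?thesis
    by (intro exI[of _ "upper_entropy V \<tau>0"] exI[of _ "lower_entropy V \<tau>0"] exI[of _ S] conjI
        entropies_upper_semicontinuous[OF V] Pi_I entropies_in_range[OF V] allI impI ballI S sofic same) auto
qed

end
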